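(* Let $k\in\{1,2,3\}$, $a>0$, $c\neq0$, and let $(\mu,\sigma)$ be real parameters with $\sigma\leq\mu$, $\sigma<-\mu$ and $P(1,0,k)<1$, where $P$ is defined in the context. Then there is some $\delta_1\in(0,|a/c|)$ with $P(\delta_1,c,k)<\delta_1$. Furthermore, for $\delta\in(0,\delta_1]$ let $\delta_2=\delta e^{-k(|\mu|+|\sigma|)(a+|c|\delta)}$; if $|\varphi(t)|<\delta_2$ for all $t\in[-a-|c|\delta,0]$, then the solution of $$\dot u(t)=\mu u(t)+\sigma u(t-a-cu(t)),\quad t\geq0,\qquad u(t)=\varphi(t),\quad t\leq0,$$ satisfies $|u(t)|\leq\delta$ for all $t\geq0$ and $\lim_{t\to\infty}u(t)=0$.
   Context: All quantities are real and scalar. The initial function $\varphi$ is continuous; a solution is a $C^1$ function on $[0,t_f)$ satisfying the equation there with $u=\varphi$ for $t\leq 0$. Definition of $P$. Let $a>0$, $\sigma\leq\mu$, $\sigma<-\mu$ (so $\sigma<0$). For a real number $\gamma$, $\delta>0$ with $|\gamma|\delta<a$, and $\hat u\in[-\delta,-\delta\mu/\sigma]$, put $$r_+=a+\gamma\delta,\quad D_1=(|\mu|+|\sigma|)\bigl(1+(|\mu|+|\sigma|)|\gamma|\delta\bigr),\quad D_2=\bigl(D_1^2+(|\mu|+|\sigma|)^3|\gamma|\delta\bigr)\bigl(1+|\sigma\gamma|\delta\bigr).$$ Define functions $\eta_{(k)}$ on $[-r_+,0]$, with $\eta_{(k)}(0)=\hat u$, by: - $\eta_{(1)}(\theta)=-\delta$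 for $\theta\in[-r_+,0)$, $\eta_{(1)}(0)=\hat u$; - $\eta_{(2)}(\theta)=\hat u+D_1\delta\theta$ for $\theta\geq-\frac{\delta+\hat u}{D_1\delta}$, and $\eta_{(2)}(\theta)=-\delta$ for $\theta\leq-\frac{\delta+\hat u}{D_1\delta}$; - $\eta_{(3)}(\theta)=\bar\eta_{(3)}(\theta+\theta_{\rm shift})$, where $\bar\eta_{(3)}(\theta)=-\delta$ for $\theta\leq0$, $\bar\eta_{(3)}(\theta)=-\delta+\frac{\delta}{2}D_2\theta^2$ for $\theta\in(0,\frac{D_1}{D_2})$, $\bar\eta_{(3)}(\theta)=-\delta-\frac{\delta D_1^2}{2D_2}+\delta D_1\theta$ for $\theta\geq\frac{D_1}{D_2}$, and $\theta_{\rm shift}=\left(\frac{2(\hat u+\delta)}{D_2\delta}\right)^{1/2}$ if $\hat u\in[-\delta,-\delta+\frac{\delta D_1^2}{2D_2}]$, $\theta_{\rm shift}=\frac{1}{D_1\delta}\bigl(\hat u+\delta+\frac{\delta D_1^2}{2D_2}\bigr)$ if $\hat u>-\delta+\frac{\delta D_1^2}{2D_2}$. Set $$\mathcal I(\hat u,\delta,\gamma,k)=\hat u e^{\mu r_+}+\sigma\int_{-r_+}^0e^{-\mu\theta}\eta_{(k)}(\theta)\,d\theta,\qquad P(\delta,\gamma,k)=\sup_{\hat u\in[-\delta,-\delta\mu/\sigma]}\mathcal I(\hat u,\delta,|\gamma|,k).$$ (Thus $P(1,0,k)$ is computed with $\gamma=0$, $\delta=1$, $r_+=a$.) $P$ also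 depends on $\mu,\sigma,a$. *)

theory Defs
  imports "HOL-Analysis.Analysis"
begin

definition r_plus :: "real \<Rightarrow> real \<Rightarrow> real \<Rightarrow> real" where
  "r_plus a \<delta> \<gamma> = a + \<gamma> * \<delta>"

definition D1 :: "real \<Rightarrow> real \<Rightarrow> real \<Rightarrow> real \<Rightarrow> real" where
  "D1 \<mu> \<sigma> \<delta> \<gamma> = (\<bar>\<mu>\<bar> + \<bar>\<sigma>\<bar>) * (1 + (\<bar>\<mu>\<bar> + \<bar>\<sigma>\<bar>) * \<bar>\<gamma>\<bar> * \<delta>)"

definition D2 :: "real \<Rightarrow> real \<Rightarrow> real \<Rightarrow> real \<Rightarrow> real" where
  "D2 \<mu> \<sigma> \<delta> \<gamma> =
     ((D1 \<mu> \<sigma> \<delta> \<gamma>)\<^sup>2 + (\<bar>\<mu>\<bar> + \<bar>\<sigma>\<bar>) ^ 3 * \<bar>\<gamma>\<bar> * \<delta>) * (1 + \<bar>\<sigma> * \<gamma>\<bar> * \<delta>)"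

text \<open>The functions below are only meaningful on \<open>[-r_plus a \<delta> \<gamma>, 0]\<close>; outside this interval
  their values are irrelevant. The argument \<open>v\<close> is the prescribed value at \<open>0\<close>.\<close>

definition eta1 :: "real \<Rightarrow> real \<Rightarrow> real \<Rightarrow> real" where
  "eta1 \<delta> v \<theta> = (if \<theta> < 0 then - \<delta> else v)"

definition eta2 :: "real \<Rightarrow> real \<Rightarrow> real \<Rightarrow> real \<Rightarrow> real \<Rightarrow> real \<Rightarrow> real" where
  "eta2 \<mu> \<sigma> \<delta> \<gamma> v \<theta> =
     (let d1 = D1 \<mu> \<sigma> \<delta> \<gamma> in
      if \<theta> \<ge> - ((\<delta> + v) / (d1 * \<delta>)) then v + d1 * \<delta> * \<theta> else - \<delta>)"

definition eta3_bar :: "real \<Rightarrow> real \<Rightarrow> real \<Rightarrow> real \<Rightarrow> real \<Rightarrow> real" where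
  "eta3_bar \<mu> \<sigma> \<delta> \<gamma> \<theta> =
     (let d1 = D1 \<mu> \<sigma> \<delta> \<gamma>; d2 = D2 \<mu> \<sigma> \<delta> \<gamma> in
      if \<theta> \<le> 0 then - \<delta>
      else if \<theta> < d1 / d2 then - \<delta> + \<delta> / 2 * d2 * \<theta>\<^sup>2
      else - \<delta> - \<delta> * d1\<^sup>2 / (2 * d2) + \<delta> * d1 * \<theta>)"

definition theta_shift :: "real \<Rightarrow> real \<Rightarrow> real \<Rightarrow> real \<Rightarrow> real \<Rightarrow> real" where
  "theta_shift \<mu> \<sigma> \<delta> \<gamma> v =
     (let d1 = D1 \<mu> \<sigma> \<delta> \<gamma>; d2 = D2 \<mu> \<sigma> \<delta> \<gamma> in
      if v \<le> - \<delta> + \<delta> * d1\<^sup>2 / (2 * d2) then sqrt (2 * (v + \<delta>) / (d2 * \<delta>))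
      else 1 / (d1 * \<delta>) * (v + \<delta> + \<delta> * d1\<^sup>2 / (2 * d2)))"

definition eta3 :: "real \<Rightarrow> real \<Rightarrow> real \<Rightarrow> real \<Rightarrow> real \<Rightarrow> real \<Rightarrow> real" where
  "eta3 \<mu> \<sigma> \<delta> \<gamma> v \<theta> = eta3_bar \<mu> \<sigma> \<delta> \<gamma> (\<theta> + theta_shift \<mu> \<sigma> \<delta> \<gamma> v)"

text \<open>Only the indices \<open>k = 1, 2, 3\<close> are meaningful.\<close>

definition eta :: "nat \<Rightarrow> real \<Rightarrow> real \<Rightarrow> real \<Rightarrow> real \<Rightarrow> real \<Rightarrow> real \<Rightarrow> real" where
  "eta k \<mu> \<sigma> \<delta> \<gamma> v \<theta> =
     (if k = 1 then eta1 \<delta> v \<theta>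
      else if k = 2 then eta2 \<mu> \<sigma> \<delta> \<gamma> v \<theta>
      else eta3 \<mu> \<sigma> \<delta> \<gamma> v \<theta>)"

definition Ifun :: "real \<Rightarrow> real \<Rightarrow> real \<Rightarrow> real \<Rightarrow> real \<Rightarrow> real \<Rightarrow> nat \<Rightarrow> real" where
  "Ifun \<mu> \<sigma> a v \<delta> \<gamma> k =
     v * exp (\<mu> * r_plus a \<delta> \<gamma>) +
     \<sigma> * integral {- r_plus a \<delta> \<gamma>..0} (\<lambda>\<theta>. exp (- \<mu> * \<theta>) * eta k \<mu> \<sigma> \<delta> \<gamma> v \<theta>)"

definition Pfun :: "real \<Rightarrow> real \<Rightarrow> real \<Rightarrow> real \<Rightarrow> real \<Rightarrow> nat \<Rightarrow> real" where
  "Pfun \<mu> \<sigma> a \<delta> \<gamma> k = (SUP v\<in>{- \<delta>..- \<delta> * \<mu> / \<sigma>}. Ifun \<mu> \<sigma> a v \<delta> \<bar>\<gamma>\<bar> k)"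

text \<open>
  \<open>dde_solution \<mu> \<sigma> a c \<phi> T u\<close>: the function \<open>u\<close> is a solution on \<open>[0,T)\<close>, where \<open>T = \<infinity>\<close> is
  allowed, of \<open>u'(t) = \<mu> u(t) + \<sigma> u(t - a - c u(t))\<close> with \<open>u = \<phi>\<close> on \<open>(-\<infinity>,0]\<close>. The derivative
  is taken within \<open>[0,T)\<close>, hence is one-sided at \<open>0\<close>. As \<open>u\<close> is a total function whose values
  beyond \<open>T\<close> are junk, the deviated argument is required to lie in \<open>(-\<infinity>,T)\<close>.
\<close>

definition dde_solution ::
  "real \<Rightarrow> real \<Rightarrow> real \<Rightarrow> real \<Rightarrow> (real \<Rightarrow> real) \<Rightarrow> ereal \<Rightarrow> (real \<Rightarrow> real) \<Rightarrow> bool" where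
  "dde_solution \<mu> \<sigma> a c \<phi> T u \<longleftrightarrow>
     0 < T \<and>
     (\<forall>t\<le>0. u t = \<phi> t) \<and>
     (\<exists>u'. continuous_on {t. 0 \<le> t \<and> ereal t < T} u' \<and>
       (\<forall>t. 0 \<le> t \<and> ereal t < T \<longrightarrow>
          (u has_real_derivative u' t) (at t within {t. 0 \<le> t \<and> ereal t < T}) \<and>
          ereal (t - a - c * u t) < T \<and>
          u' t = \<mu> * u t + \<sigma> * u (t - a - c * u t)))"

text \<open>A solution that cannot be continued to a larger interval.\<close>

definition maximal_dde_solution ::
  "real \<Rightarrow> real \<Rightarrow> real \<Rightarrow> real \<Rightarrow> (real \<Rightarrow> real) \<Rightarrow> ereal \<Rightarrow> (real \<Rightarrow> real) \<Rightarrow> bool" where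
  "maximal_dde_solution \<mu> \<sigma> a c \<phi> T u \<longleftrightarrow>
     dde_solution \<mu> \<sigma> a c \<phi> T u \<and>
     \<not> (\<exists>T' v. T < T' \<and> dde_solution \<mu> \<sigma> a c \<phi> T' v \<and> (\<forall>t. ereal t < T \<longrightarrow> v t = u t))"

end

theory Submission
  imports Defs "HOL-Complex_Analysis.Great_Picard"
begin

text \<open>
  The argument is of Lyapunov--Razumikhin type. If \<open>\<bar>u\<bar> \<le> \<delta>\<close> and \<open>u t = \<delta>\<close> with \<open>u' t \<ge> 0\<close>, then
  the equation forces \<open>v = u (t - \<tau>) \<le> - \<delta> * \<mu> / \<sigma>\<close>, where \<open>\<tau> = a + c * \<delta>\<close>. Bounds for the first
  \<open>k - 1\<close> derivatives of \<open>w s = u (s - a - c * u s)\<close> show that \<open>w\<close> lies above the extremal profile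
  \<open>eta k\<close> ending at \<open>v\<close>, so variation of constants over \<open>[t - \<tau>, t]\<close> bounds \<open>u t\<close> by the functional
  with supremum \<open>P < \<delta>\<close>, a contradiction. By continuity the same contradiction arises if
  \<open>u t \<ge> (1 - \<epsilon>) * \<delta>\<close> and \<open>u' t \<ge> - \<epsilon> * \<delta>\<close>; hence a bound on \<open>\<bar>u\<bar>\<close> eventually improves by the factor
  \<open>1 - \<epsilon>\<close>, and \<open>u\<close> tends to zero. The derivative bounds need \<open>k\<close> delays of history, during which
  \<open>\<bar>u\<bar> < \<delta>\<close> is ensured by Gronwall's inequality and the choice of \<open>\<delta>2\<close>.
\<close>

section \<open>Ramp functions\<close>

lemma within_deriv_nonneg_imp_le:
  fixes f :: "real \<Rightarrow> real"
  assumes "a \<le> b"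
    and "\<And>x. x \<in> {a..b} \<Longrightarrow> (f has_real_derivative f' x) (at x within {a..b})"
    and "\<And>x. x \<in> {a..b} \<Longrightarrow> 0 \<le> f' x"
  shows "f a \<le> f b"
proof -
  obtain x where "x \<in> {a..b}" "f b - f a = f' x * (b - a)"
    using mvt_very_simple[OF assms(1), of f "\<lambda>x. (*) (f' x)"] assms(2)
    by (auto simp: has_field_derivative_def)
  then show ?thesis
    using assms(1) assms(3)[of x] by (smt (verit) mult_nonneg_nonneg)
qed

lemma has_real_derivative_max_0_square:
  "((\<lambda>x. (max 0 x)\<^sup>2) has_real_derivative 2 * max 0 x) (at (x::real))"
proof -
  consider "x < 0" | "x = 0" | "x > 0" by linarith
  then show ?thesis
  proof cases
    case 1
    have "((\<lambda>x. 0) has_real_derivative 2 * max 0 x) (at x)"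
      using 1 by simp
    then show ?thesis
      by (rule has_field_derivative_transform_within_open[where S = "{..<0}"]) (use 1 in auto)
  next
    case 2
    have "((\<lambda>h. (max 0 h)\<^sup>2 / h) \<longlongrightarrow> 0) (at (0::real))"
    proof (rule Lim_null_comparison)
      show "\<forall>\<^sub>F h in at 0. norm ((max 0 h)\<^sup>2 / h) \<le> \<bar>h::real\<bar>"
        by (rule always_eventually) (auto simp: max_def power2_eq_square)
      show "((\<lambda>h::real. \<bar>h\<bar>) \<longlongrightarrow> 0) (at 0)"
        by (auto intro!: tendsto_eq_intros)
    qed
    then show ?thesis
      using 2 by (simp add: DERIV_def)
  next
    case 3
    have "((\<lambda>x. x\<^sup>2) has_real_derivative 2 * max 0 x) (at x)"
      using 3 by (auto intro!: derivative_eq_intros)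
    then show ?thesis
      by (rule has_field_derivative_transform_within_open[where S = "{0<..}"]) (use 3 in auto)
  qed
qed

definition ramp :: "real \<Rightarrow> real \<Rightarrow> real \<Rightarrow> real" where
  "ramp p q x = q / 2 * (max 0 x)\<^sup>2 - q / 2 * (max 0 (x - p / q))\<^sup>2"

definition ramp_inv :: "real \<Rightarrow> real \<Rightarrow> real \<Rightarrow> real" where
  "ramp_inv p q y = (if y \<le> p\<^sup>2 / (2 * q) then sqrt (2 * y / q) else (y + p\<^sup>2 / (2 * q)) / p)"

locale ramp_slopes =
  fixes p q :: real
  assumes p_pos: "0 < p" and q_pos: "0 < q"
begin

lemma ramp_nonpos_arg: "x \<le> 0 \<Longrightarrow> ramp p q x = 0"
proof -
  assume "x \<le> 0"
  moreover have "0 < p / q" using p_pos q_pos by simp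
  ultimately have "max 0 x = 0" "max 0 (x - p / q) = 0" by auto
  then show ?thesis by (simp add: ramp_def)
qed

lemma ramp_quadratic: "0 \<le> x \<Longrightarrow> x \<le> p / q \<Longrightarrow> ramp p q x = q / 2 * x\<^sup>2"
  by (simp add: ramp_def max_def)

lemma ramp_linear: "p / q \<le> x \<Longrightarrow> ramp p q x = p * x - p\<^sup>2 / (2 * q)"
proof -
  assume *: "p / q \<le> x"
  have "0 < p / q" using p_pos q_pos by simp
  with * have "max 0 x = x" "max 0 (x - p / q) = x - p / q" by auto
  then have "ramp p q x = q / 2 * x\<^sup>2 - q / 2 * (x - p / q)\<^sup>2" by (simp add: ramp_def)
  also have "\<dots> = p * x - p\<^sup>2 / (2 * q)"
    using q_pos by (simp add: power2_eq_square field_simps)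
  finally show ?thesis .
qed

lemma has_real_derivative_ramp:
  "(ramp p q has_real_derivative min p (q * max 0 x)) (at x)"
proof -
  have 1: "((\<lambda>x. (max 0 (x - p / q))\<^sup>2) has_real_derivative 2 * max 0 (x - p / q)) (at x)"
    using DERIV_chain2[OF has_real_derivative_max_0_square, of "\<lambda>x. x - p / q" 1 x UNIV]
    by (simp add: DERIV_diff[OF DERIV_ident DERIV_const, simplified])
  have "((\<lambda>x. q / 2 * (max 0 x)\<^sup>2 - q / 2 * (max 0 (x - p / q))\<^sup>2) has_real_derivative
      q / 2 * (2 * max 0 x) - q / 2 * (2 * max 0 (x - p / q))) (at x)"
    by (intro DERIV_diff DERIV_cmult has_real_derivative_max_0_square 1)
  moreover have "q / 2 * (2 * max 0 x) - q / 2 * (2 * max 0 (x - p / q)) = min p (q * max 0 x)"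
    using p_pos q_pos mult_pos_neg[of q x] by (auto simp: max_def min_def field_simps)
  ultimately show ?thesis by (simp add: ramp_def[abs_def])
qed

lemma continuous_on_ramp: "continuous_on S (ramp p q)"
  by (rule DERIV_continuous_on, rule has_field_derivative_at_within, rule has_real_derivative_ramp)

lemma mono_ramp: "x \<le> y \<Longrightarrow> ramp p q x \<le> ramp p q y"
  by (rule within_deriv_nonneg_imp_le[OF _ has_field_derivative_at_within[OF has_real_derivative_ramp]])
    (use p_pos q_pos in auto)

lemma strict_mono_ramp: "0 \<le> x \<Longrightarrow> x < y \<Longrightarrow> ramp p q x < ramp p q y"
proof -
  assume x: "0 \<le> x" "x < y"
  show ?thesis
  proof (rule DERIV_pos_imp_increasing_open[OF x(2)])
    fix z assume z: "x < z" "z < y"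
    then have "0 < min p (q * max 0 z)" using x p_pos q_pos by simp
    then show "\<exists>d. (ramp p q has_real_derivative d) (at z) \<and> 0 < d"
      using has_real_derivative_ramp by blast
  qed (rule continuous_on_ramp)
qed

lemma ramp_nonneg: "0 \<le> ramp p q x"
  using mono_ramp[of 0 x] ramp_nonpos_arg[of x] ramp_nonpos_arg[of 0] by linarith

lemma ramp_lipschitz: "x \<le> y \<Longrightarrow> ramp p q y - ramp p q x \<le> p * (y - x)"
proof -
  assume "x \<le> y"
  then have "p * x - ramp p q x \<le> p * y - ramp p q y"
    by (rule within_deriv_nonneg_imp_le[OF _ DERIV_diff[OF DERIV_cmult_Id
            has_field_derivative_at_within[OF has_real_derivative_ramp]]]) auto
  then show ?thesis by (simp add: algebra_simps)
qed

lemma ramp_inv_nonneg: "0 \<le> y \<Longrightarrow> 0 \<le> ramp_inv p q y"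
  using p_pos q_pos by (auto simp: ramp_inv_def intro!: divide_nonneg_pos add_nonneg_nonneg)

lemma ramp_ramp_inv: "0 \<le> y \<Longrightarrow> ramp p q (ramp_inv p q y) = y"
proof (cases "y \<le> p\<^sup>2 / (2 * q)")
  case True
  assume y: "0 \<le> y"
  have "2 * y / q \<le> (p / q)\<^sup>2"
    using True q_pos by (simp add: field_simps power2_eq_square)
  then have "sqrt (2 * y / q) \<le> p / q"
    using p_pos q_pos by (auto intro: real_le_lsqrt)
  then show ?thesis
    using True y q_pos by (simp add: ramp_inv_def ramp_quadratic)
next
  case False
  have "p / q \<le> (y + p\<^sup>2 / (2 * q)) / p"
    using False p_pos q_pos by (simp add: field_simps power2_eq_square)
  then show ?thesis
    using False p_pos by (simp add: ramp_inv_def ramp_linear)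
qed

lemma mono_ramp_inv: "0 \<le> y \<Longrightarrow> y \<le> z \<Longrightarrow> ramp_inv p q y \<le> ramp_inv p q z"
  using strict_mono_ramp[of "ramp_inv p q z" "ramp_inv p q y"] ramp_inv_nonneg[of z]
    ramp_ramp_inv[of y] ramp_ramp_inv[of z] by fastforce

lemma ramp_slope_square: "(min p (q * max 0 x))\<^sup>2 \<le> 2 * q * ramp p q x"
proof -
  consider "x \<le> 0" | "0 < x" "x < p / q" | "p / q \<le> x" by linarith
  then show ?thesis
  proof cases
    case 1 then show ?thesis using p_pos by (simp add: ramp_nonpos_arg)
  next
    case 2
    then show ?thesis
      using q_pos by (simp add: ramp_quadratic field_simps power2_eq_square min_def)
  next
    case 3
    have "0 < p / q" using p_pos q_pos by simp
    with 3 have x: "0 < x" by linarith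
    have px: "p \<le> q * x" using 3 q_pos by (simp add: field_simps)
    then have "p * p \<le> p * (q * x)" using p_pos by (intro mult_left_mono) auto
    moreover have "2 * q * (p * x - p\<^sup>2 / (2 * q)) = 2 * (p * (q * x)) - p * p"
      using q_pos by (simp add: field_simps power2_eq_square)
    ultimately show ?thesis
      using 3 px x by (simp add: ramp_linear min_def power2_eq_square)
  qed
qed

text \<open>A function with slope at most \<open>p\<close> and curvature at most \<open>q\<close> rises from its value at \<open>s\<close> at
  most as fast as the ramp through the same value, provided that its initial slope does not exceed
  the slope of the ramp at that height, which is \<open>sqrt (2 * q * height)\<close> on the quadratic part.\<close>

lemma ramp_comparison:
  assumes t: "0 \<le> t"
    and f: "\<And>x. x \<in> {s..s+t} \<Longrightarrow> (f has_real_derivative f' x) (at x within {s..s+t})"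
    and nonneg: "0 \<le> f s" "0 \<le> f (s + t)"
    and slope: "\<And>x. x \<in> {s..s+t} \<Longrightarrow> f' x \<le> p"
    and curv: "\<And>x. x \<in> {s..s+t} \<Longrightarrow> f' x - f' s \<le> q * (x - s)"
    and start: "f' s \<le> 0 \<or> (f' s)\<^sup>2 \<le> 2 * q * f s"
  shows "ramp p q (ramp_inv p q (f (s + t)) - t) \<le> f s"
proof -
  define z where "z = ramp_inv p q (f s)"
  have z: "0 \<le> z" "ramp p q z = f s"
    using nonneg by (auto simp: z_def ramp_inv_nonneg ramp_ramp_inv)
  have init: "f' s \<le> q * z"
  proof (cases "f s \<le> p\<^sup>2 / (2 * q)")
    case True
    show ?thesis
    proof (cases "f' s \<le> 0")
      case True
      then show ?thesis using z q_pos by (smt (verit) mult_nonneg_nonneg)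
    next
      case False
      then have sq: "(f' s)\<^sup>2 \<le> 2 * q * f s" using start by blast
      have "(q * z)\<^sup>2 = 2 * q * f s"
        using True nonneg q_pos
        by (simp add: z_def ramp_inv_def power_mult_distrib) (simp add: power2_eq_square)
      with sq have "(f' s)\<^sup>2 \<le> (q * z)\<^sup>2" by simp
      then show ?thesis by (rule power2_le_imp_le) (use z q_pos in auto)
    qed
  next
    case False
    then have "p \<le> q * z"
      using p_pos q_pos by (simp add: z_def ramp_inv_def field_simps power2_eq_square)
    moreover have "f' s \<le> p" using slope[of s] t by auto
    ultimately show ?thesis by linarith
  qed
  have "f (s + t) \<le> ramp p q (z + t)"
  proof -
    let ?g = "\<lambda>x. ramp p q (z + (x - s)) - f x"
    have "?g s \<le> ?g (s + t)"
    proof (rule within_deriv_nonneg_imp_le[where f = ?g and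
          f' = "\<lambda>x. min p (q * max 0 (z + (x - s))) - f' x"])
      show "s \<le> s + t" using t by simp
      fix x assume x: "x \<in> {s..s+t}"
      have "((\<lambda>x. ramp p q (z + (x - s))) has_real_derivative min p (q * max 0 (z + (x - s))) * 1)
          (at x within {s..s+t})"
        by (rule DERIV_chain2[OF has_real_derivative_ramp]) (auto intro!: derivative_eq_intros)
      then show "(?g has_real_derivative min p (q * max 0 (z + (x - s))) - f' x) (at x within {s..s+t})"
        using DERIV_diff[OF _ f[OF x]] by simp
      have "f' x \<le> q * (z + (x - s))" using curv[OF x] init by (simp add: algebra_simps)
      then show "0 \<le> min p (q * max 0 (z + (x - s))) - f' x"
        using slope[OF x] x z by auto
    qed
    then show ?thesis using z by simp
  qed
  then have "ramp_inv p q (f (s + t)) \<le> z + t"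
    using strict_mono_ramp[of "z + t" "ramp_inv p q (f (s + t))"] z t ramp_ramp_inv[OF nonneg(2)]
    by fastforce
  then show ?thesis using mono_ramp[of "ramp_inv p q (f (s + t)) - t" z] z by auto
qed

end

section \<open>Normalised profiles and the functional they define\<close>

definition prof :: "nat \<Rightarrow> real \<Rightarrow> real \<Rightarrow> real \<Rightarrow> real \<Rightarrow> real" where
  "prof k p q v \<theta> =
     (if k = 1 then - 1
      else if k = 2 then max (- 1) (v + p * \<theta>)
      else ramp p q (ramp_inv p q (v + 1) + \<theta>) - 1)"

context ramp_slopes
begin

lemma continuous_on_prof: "continuous_on S (prof k p q v)"
proof -
  have "continuous_on S (\<lambda>\<theta>. ramp p q (ramp_inv p q (v + 1) + \<theta>))"
    by (rule continuous_on_compose2[OF continuous_on_ramp[of UNIV]])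
      (auto intro!: continuous_intros)
  then show ?thesis
    by (cases "k = 1"; cases "k = 2") (auto simp: prof_def[abs_def] intro!: continuous_intros)
qed

lemma prof_ge: "- 1 \<le> prof k p q v \<theta>"
  using ramp_nonneg by (auto simp: prof_def)

lemma mono_prof: "x \<le> y \<Longrightarrow> prof k p q v x \<le> prof k p q v y"
proof -
  assume "x \<le> y"
  then have "p * x \<le> p * y" using p_pos by simp
  with \<open>x \<le> y\<close> show ?thesis
    unfolding prof_def using mono_ramp[of "ramp_inv p q (v + 1) + x" "ramp_inv p q (v + 1) + y"]
    by (simp add: max_def)
qed

lemma prof_le: "- 1 \<le> v \<Longrightarrow> \<theta> \<le> 0 \<Longrightarrow> prof k p q v \<theta> \<le> v"
  using mono_prof[of \<theta> 0 k v] ramp_ramp_inv[of "v + 1"] by (auto simp: prof_def split: if_splits)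

lemma mono_prof_value: "- 1 \<le> v \<Longrightarrow> v \<le> w \<Longrightarrow> prof k p q v \<theta> \<le> prof k p q w \<theta>"
  using mono_ramp_inv[of "v + 1" "w + 1"] by (auto simp: prof_def intro!: mono_ramp)

lemma prof_lipschitz: "x \<le> y \<Longrightarrow> prof k p q v y - prof k p q v x \<le> p * (y - x)"
proof -
  assume xy: "x \<le> y"
  then have "p * x \<le> p * y" using p_pos by simp
  then have "max (- 1) (v + p * y) - max (- 1) (v + p * x) \<le> p * (y - x)"
    by (auto simp: max_def algebra_simps)
  moreover have "0 \<le> p * (y - x)" using p_pos xy by simp
  ultimately show ?thesis
    using ramp_lipschitz[of "ramp_inv p q (v + 1) + x" "ramp_inv p q (v + 1) + y"] xy
    by (auto simp: prof_def)
qed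

lemma prof_scale:
  assumes "0 < l"
  shows "prof k (l * p) (l\<^sup>2 * q) v \<theta> = prof k p q v (l * \<theta>)"
proof -
  have max_scale: "(max 0 (l * x))\<^sup>2 = l\<^sup>2 * (max 0 x)\<^sup>2" for x
    using assms by (simp add: max_def power_mult_distrib zero_le_mult_iff)
  have shift: "l * x - p / q = l * (x - (l * p) / (l\<^sup>2 * q))" for x
    using assms q_pos by (simp add: field_simps power2_eq_square)
  have 1: "ramp (l * p) (l\<^sup>2 * q) x = ramp p q (l * x)" for x
    by (simp only: ramp_def shift max_scale) (simp add: algebra_simps)
  have same: "(l * p)\<^sup>2 / (2 * (l\<^sup>2 * q)) = p\<^sup>2 / (2 * q)"
    using assms by (simp add: power2_eq_square)
  have root: "l * sqrt (2 * y / (l\<^sup>2 * q)) = sqrt (2 * y / q)" for y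
    using assms by (simp add: real_sqrt_mult real_sqrt_divide)
  have 2: "l * ramp_inv (l * p) (l\<^sup>2 * q) y = ramp_inv p q y" for y
    using assms root[of y] by (simp add: ramp_inv_def same)
  have "l * p * \<theta> = p * (l * \<theta>)" by simp
  then show ?thesis
    unfolding prof_def 1 distrib_left 2 by presburger
qed

lemma prof_antimono:
  assumes "p \<le> p'" "q \<le> q'" "- 1 \<le> v" "\<theta> \<le> 0"
  shows "prof k p' q' v \<theta> \<le> prof k p q v \<theta>"
proof -
  interpret r': ramp_slopes p' q' using assms p_pos q_pos by unfold_locales auto
  have "ramp p' q' (ramp_inv p' q' (v + 1) + \<theta>) \<le> ramp p q (ramp_inv p q (v + 1) + \<theta>)"
  proof -
    let ?z = "ramp_inv p q (v + 1)"
    let ?d = "\<lambda>x. min p (q * max 0 (?z + x))"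
    have "ramp p' q' (ramp_inv p' q' (ramp p q (?z + (\<theta> + (- \<theta>)))) - (- \<theta>)) \<le> ramp p q (?z + \<theta>)"
    proof (rule r'.ramp_comparison[where f = "\<lambda>x. ramp p q (?z + x)" and f' = ?d])
      fix x assume x: "x \<in> {\<theta>..\<theta> + - \<theta>}"
      show "((\<lambda>x. ramp p q (?z + x)) has_real_derivative ?d x) (at x within {\<theta>..\<theta> + - \<theta>})"
        using DERIV_chain2[OF has_real_derivative_ramp, of "\<lambda>x. ?z + x" 1 x "{\<theta>..\<theta> + - \<theta>}"]
        by (simp add: DERIV_add[OF DERIV_const DERIV_ident, simplified])
      show "?d x \<le> p'" using assms by auto
      have "q * max 0 (?z + x) \<le> q * max 0 (?z + \<theta>) + q * (x - \<theta>)"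
        using x q_pos by (simp flip: distrib_left)
      moreover have "q * (x - \<theta>) \<le> q' * (x - \<theta>)"
        using x assms by (intro mult_right_mono) auto
      moreover have "0 \<le> q * (x - \<theta>)" using x q_pos by auto
      ultimately show "?d x - ?d \<theta> \<le> q' * (x - \<theta>)" by linarith
    next
      have "2 * q * ramp p q (?z + \<theta>) \<le> 2 * q' * ramp p q (?z + \<theta>)"
        using assms ramp_nonneg by (intro mult_right_mono) auto
      then show "?d \<theta> \<le> 0 \<or> (?d \<theta>)\<^sup>2 \<le> 2 * q' * ramp p q (?z + \<theta>)"
        using ramp_slope_square[of "?z + \<theta>"] by linarith
    qed (use assms ramp_nonneg in auto)
    then show ?thesis using assms by (simp add: ramp_ramp_inv)
  qed
  moreover have "p' * \<theta> \<le> p * \<theta>" using assms by (intro mult_right_mono_neg)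
  ultimately show ?thesis by (auto simp: prof_def)
qed

end

lemma eta_eq_prof:
  assumes "\<delta> > 0" "ramp_slopes (D1 \<mu> \<sigma> \<delta> \<gamma>) (D2 \<mu> \<sigma> \<delta> \<gamma>)" "k \<in> {1, 2, 3}" "k = 1 \<longrightarrow> \<theta> < 0"
  shows "eta k \<mu> \<sigma> \<delta> \<gamma> v \<theta> = \<delta> * prof k (D1 \<mu> \<sigma> \<delta> \<gamma>) (D2 \<mu> \<sigma> \<delta> \<gamma>) (v / \<delta>) \<theta>"
proof -
  define p q where "p = D1 \<mu> \<sigma> \<delta> \<gamma>" "q = D2 \<mu> \<sigma> \<delta> \<gamma>"
  note pq = this[symmetric]
  interpret ramp_slopes p q using assms(2) by (simp add: pq)
  have 2: "eta2 \<mu> \<sigma> \<delta> \<gamma> v \<theta> = \<delta> * max (- 1) (v / \<delta> + p * \<theta>)"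
  proof -
    have "\<delta> * max (- 1) (v / \<delta> + p * \<theta>) = max (- \<delta>) (v + p * \<delta> * \<theta>)"
      using assms(1) by (subst max_mult_distrib_left) (simp add: algebra_simps)
    moreover have "- ((\<delta> + v) / (p * \<delta>)) \<le> \<theta> \<longleftrightarrow> - \<delta> \<le> v + p * \<delta> * \<theta>"
      using assms(1) p_pos by (simp add: field_simps)
    ultimately show ?thesis by (simp add: eta2_def Let_def pq max_def)
  qed
  have bar: "eta3_bar \<mu> \<sigma> \<delta> \<gamma> x = \<delta> * (ramp p q x - 1)" for x
  proof -
    consider "x \<le> 0" | "0 < x" "x < p / q" | "0 < x" "p / q \<le> x" by linarith
    then show ?thesis
    proof cases
      case 1
      then show ?thesis by (simp add: eta3_bar_def ramp_nonpos_arg)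
    next
      case 2
      then show ?thesis by (simp add: eta3_bar_def Let_def pq ramp_quadratic algebra_simps)
    next
      case 3
      then show ?thesis by (simp add: eta3_bar_def Let_def pq ramp_linear algebra_simps)
    qed
  qed
  have shift: "theta_shift \<mu> \<sigma> \<delta> \<gamma> v = ramp_inv p q (v / \<delta> + 1)"
  proof -
    have 1: "2 * (v + \<delta>) / (q * \<delta>) = 2 * (v / \<delta> + 1) / q"
      using assms(1) q_pos by (simp add: field_simps)
    have 2: "v \<le> - \<delta> + \<delta> * p\<^sup>2 / (2 * q) \<longleftrightarrow> v / \<delta> + 1 \<le> p\<^sup>2 / (2 * q)"
      using assms(1) q_pos by (simp add: field_simps)
    have 3: "1 / (p * \<delta>) * (v + \<delta> + \<delta> * p\<^sup>2 / (2 * q)) = (v / \<delta> + 1 + p\<^sup>2 / (2 * q)) / p"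
      using assms(1) q_pos p_pos by (simp add: field_simps)
    show ?thesis by (simp only: theta_shift_def Let_def pq ramp_inv_def 1 2 3)
  qed
  show ?thesis
    using assms(3,4) by (auto simp: eta_def prof_def pq 2 eta3_def bar shift eta1_def add.commute)
qed

definition Jf :: "real \<Rightarrow> real \<Rightarrow> (real \<Rightarrow> real) \<Rightarrow> real \<Rightarrow> real \<Rightarrow> real" where
  "Jf \<mu> \<sigma> \<eta> v r = v * exp (\<mu> * r) + \<sigma> * integral {- r..0} (\<lambda>\<theta>. exp (- \<mu> * \<theta>) * \<eta> \<theta>)"

lemma integrable_exp_mult:
  fixes \<eta> :: "real \<Rightarrow> real"
  shows "continuous_on {x..y} \<eta> \<Longrightarrow> (\<lambda>\<theta>. exp (- (\<mu> * \<theta>)) * \<eta> \<theta>) integrable_on {x..y}"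
  by (intro integrable_continuous_real continuous_intros)

lemma Jf_0 [simp]: "Jf \<mu> \<sigma> \<eta> v 0 = v"
  by (simp add: Jf_def)

lemma Jf_diff:
  assumes "continuous_on UNIV \<eta>" "0 \<le> r" "r \<le> s"
  shows "Jf \<mu> \<sigma> \<eta> v s - Jf \<mu> \<sigma> \<eta> v r =
    integral {- s..- r} (\<lambda>\<theta>. exp (- \<mu> * \<theta>) * (\<mu> * v + \<sigma> * \<eta> \<theta>))"
proof -
  let ?h = "\<lambda>\<theta>. exp (- \<mu> * \<theta>) * \<eta> \<theta>"
  have cont: "continuous_on A \<eta>" for A using assms(1) continuous_on_subset by blast
  have "integral {- s..- r} ?h + integral {- r..0} ?h = integral {- s..0} ?h"
    by (rule Henstock_Kurzweil_Integration.integral_combine)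
      (use assms in \<open>auto intro!: integrable_exp_mult cont\<close>)
  moreover have "((\<lambda>\<theta>. exp (- \<mu> * \<theta>) * \<mu>) has_integral
      (- exp (- \<mu> * (- r))) - (- exp (- \<mu> * (- s)))) {- s..- r}"
    using assms
    by (intro fundamental_theorem_of_calculus)
      (auto intro!: derivative_eq_intros simp flip: has_real_derivative_iff_has_vector_derivative)
  then have "integral {- s..- r} (\<lambda>\<theta>. exp (- \<mu> * \<theta>) * \<mu>) = exp (\<mu> * s) - exp (\<mu> * r)"
    by (subst integral_unique) (assumption, simp)
  moreover have "integral {- s..- r} (\<lambda>\<theta>. exp (- \<mu> * \<theta>) * (\<mu> * v + \<sigma> * \<eta> \<theta>)) =
      v * integral {- s..- r} (\<lambda>\<theta>. exp (- \<mu> * \<theta>) * \<mu>) + \<sigma> * integral {- s..- r} ?h"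
    by (subst Henstock_Kurzweil_Integration.integral_mult_right[symmetric])+
      (subst Henstock_Kurzweil_Integration.integral_add[symmetric],
       auto intro!: integrable_continuous_real continuous_intros cont simp: algebra_simps)
  moreover have "X = v * y + \<sigma> * B \<Longrightarrow> B + C = A \<Longrightarrow> y = exp (\<mu> * s) - exp (\<mu> * r) \<Longrightarrow>
      v * exp (\<mu> * s) + \<sigma> * A - (v * exp (\<mu> * r) + \<sigma> * C) = X" for A B C X y
    by (auto simp: algebra_simps)
  ultimately show ?thesis unfolding Jf_def by blast
qed

text \<open>As a function of \<open>r\<close> the integrand of the difference is a positive multiple of the
  nondecreasing function \<open>\<mu> * v + \<sigma> * \<eta> (- r)\<close>, so \<open>Jf\<close> first decreases and then increases.\<close>

lemma Jf_le_max:
  assumes cont: "continuous_on UNIV \<eta>" and mono: "\<And>x y. x \<le> y \<Longrightarrow> \<eta> x \<le> \<eta> y"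
    and "\<sigma> < 0" "0 \<le> r" "r \<le> s"
  shows "Jf \<mu> \<sigma> \<eta> v r \<le> max v (Jf \<mu> \<sigma> \<eta> v s)"
proof -
  have cont': "continuous_on A \<eta>" for A using cont continuous_on_subset by blast
  have int: "(\<lambda>\<theta>. exp (- \<mu> * \<theta>) * (\<mu> * v + \<sigma> * \<eta> \<theta>)) integrable_on {x..y}" for x y
    by (intro integrable_continuous_real continuous_intros cont')
  show ?thesis
  proof (cases "0 \<le> \<mu> * v + \<sigma> * \<eta> (- r)")
    case True
    have "0 \<le> integral {- s..- r} (\<lambda>\<theta>. exp (- \<mu> * \<theta>) * (\<mu> * v + \<sigma> * \<eta> \<theta>))"
    proof (rule Henstock_Kurzweil_Integration.integral_nonneg[OF int])
      fix \<theta> assume "\<theta> \<in> {- s..- r}"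
      then have "\<sigma> * \<eta> (- r) \<le> \<sigma> * \<eta> \<theta>" using assms by (auto intro!: mult_left_mono_neg mono)
      then show "0 \<le> exp (- \<mu> * \<theta>) * (\<mu> * v + \<sigma> * \<eta> \<theta>)" using True by simp
    qed
    then show ?thesis using Jf_diff[OF cont assms(4,5), of \<mu> \<sigma> v] by simp
  next
    case False
    have "integral {- r..- 0} (\<lambda>\<theta>. exp (- \<mu> * \<theta>) * (\<mu> * v + \<sigma> * \<eta> \<theta>)) \<le> integral {- r..- 0} (\<lambda>\<theta>. 0)"
    proof (rule Henstock_Kurzweil_Integration.integral_le[OF int])
      fix \<theta> assume "\<theta> \<in> {- r..- 0}"
      then have "\<sigma> * \<eta> \<theta> \<le> \<sigma> * \<eta> (- r)" using assms by (auto intro!: mult_left_mono_neg mono)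
      then show "exp (- \<mu> * \<theta>) * (\<mu> * v + \<sigma> * \<eta> \<theta>) \<le> 0" using False by (simp add: mult_le_0_iff)
    qed (simp add: integrable_0)
    then show ?thesis using Jf_diff[OF cont order.refl assms(4), of \<mu> \<sigma> v] by simp
  qed
qed

lemma exp_le_exp_abs:
  fixes \<mu> :: real
  assumes "- r \<le> \<theta>" "\<theta> \<le> 0"
  shows "exp (- \<mu> * \<theta>) \<le> exp (\<bar>\<mu>\<bar> * r)"
proof -
  have "- \<mu> * \<theta> \<le> \<bar>\<mu>\<bar> * \<bar>\<theta>\<bar>" by (metis abs_ge_self abs_minus_cancel abs_mult)
  also have "\<dots> \<le> \<bar>\<mu>\<bar> * r" using assms by (intro mult_left_mono) auto
  finally show ?thesis by simp
qed

lemma Jf_perturb: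
  assumes "continuous_on {- r..0} \<eta>" "continuous_on {- r..0} \<zeta>"
    and le: "\<And>\<theta>. \<theta> \<in> {- r..0} \<Longrightarrow> \<zeta> \<theta> - C \<le> \<eta> \<theta>" and "\<sigma> \<le> 0" "0 \<le> r" "0 \<le> C"
  shows "Jf \<mu> \<sigma> \<eta> v r \<le> Jf \<mu> \<sigma> \<zeta> v r + \<bar>\<sigma>\<bar> * (C * exp (\<bar>\<mu>\<bar> * r) * r)"
proof -
  have "integral {- r..0} (\<lambda>\<theta>. exp (- \<mu> * \<theta>) * \<zeta> \<theta>) - C * exp (\<bar>\<mu>\<bar> * r) * r =
      integral {- r..0} (\<lambda>\<theta>. exp (- \<mu> * \<theta>) * \<zeta> \<theta> - C * exp (\<bar>\<mu>\<bar> * r))"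
    using assms
    by (subst Henstock_Kurzweil_Integration.integral_diff) (auto intro!: integrable_exp_mult)
  also have "\<dots> \<le> integral {- r..0} (\<lambda>\<theta>. exp (- \<mu> * \<theta>) * \<eta> \<theta>)"
  proof (rule Henstock_Kurzweil_Integration.integral_le)
    fix \<theta> assume \<theta>: "\<theta> \<in> {- r..0}"
    have "exp (- \<mu> * \<theta>) * (\<zeta> \<theta> - C) \<le> exp (- \<mu> * \<theta>) * \<eta> \<theta>"
      using le[OF \<theta>] by (intro mult_left_mono) auto
    moreover have "exp (- \<mu> * \<theta>) * C \<le> C * exp (\<bar>\<mu>\<bar> * r)"
      using exp_le_exp_abs[of r \<theta> \<mu>] \<theta> assms by (subst mult.commute) (intro mult_left_mono, auto)
    ultimately show "exp (- \<mu> * \<theta>) * \<zeta> \<theta> - C * exp (\<bar>\<mu>\<bar> * r) \<le> exp (- \<mu> * \<theta>) * \<eta> \<theta>"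
      by (simp add: algebra_simps)
  qed (use assms in \<open>auto intro!: integrable_exp_mult Henstock_Kurzweil_Integration.integrable_diff\<close>)
  finally have "integral {- r..0} (\<lambda>\<theta>. exp (- \<mu> * \<theta>) * \<zeta> \<theta>) - C * exp (\<bar>\<mu>\<bar> * r) * r \<le>
      integral {- r..0} (\<lambda>\<theta>. exp (- \<mu> * \<theta>) * \<eta> \<theta>)" .
  from mult_left_mono_neg[OF this assms(4)] show ?thesis
    using assms(4) by (simp add: Jf_def algebra_simps)
qed

lemma Jf_diff_le:
  assumes "continuous_on UNIV \<eta>" "0 \<le> r" "r \<le> s" "\<bar>v\<bar> \<le> 1"
    and bound: "\<And>\<theta>. \<theta> \<in> {- s..0} \<Longrightarrow> \<bar>\<eta> \<theta>\<bar> \<le> 1"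
  shows "\<bar>Jf \<mu> \<sigma> \<eta> v s - Jf \<mu> \<sigma> \<eta> v r\<bar> \<le> (\<bar>\<mu>\<bar> + \<bar>\<sigma>\<bar>) * exp (\<bar>\<mu>\<bar> * s) * (s - r)"
proof -
  have cont: "continuous_on A \<eta>" for A using assms(1) continuous_on_subset by blast
  have "norm (integral {- s..- r} (\<lambda>\<theta>. exp (- \<mu> * \<theta>) * (\<mu> * v + \<sigma> * \<eta> \<theta>))) \<le>
      (\<bar>\<mu>\<bar> + \<bar>\<sigma>\<bar>) * exp (\<bar>\<mu>\<bar> * s) * (- r - (- s))"
  proof (rule integral_bound)
    fix \<theta> assume \<theta>: "\<theta> \<in> {- s..- r}"
    have "\<bar>\<mu> * v + \<sigma> * \<eta> \<theta>\<bar> \<le> \<bar>\<mu>\<bar> * \<bar>v\<bar> + \<bar>\<sigma>\<bar> * \<bar>\<eta> \<theta>\<bar>"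
      by (metis abs_mult abs_triangle_ineq)
    also have "\<dots> \<le> \<bar>\<mu>\<bar> * 1 + \<bar>\<sigma>\<bar> * 1"
      using assms \<theta> by (intro add_mono mult_left_mono bound) auto
    finally have "\<bar>\<mu> * v + \<sigma> * \<eta> \<theta>\<bar> * exp (- \<mu> * \<theta>) \<le> (\<bar>\<mu>\<bar> + \<bar>\<sigma>\<bar>) * exp (\<bar>\<mu>\<bar> * s)"
      using \<theta> assms by (intro mult_mono exp_le_exp_abs) auto
    then show "norm (exp (- \<mu> * \<theta>) * (\<mu> * v + \<sigma> * \<eta> \<theta>)) \<le> (\<bar>\<mu>\<bar> + \<bar>\<sigma>\<bar>) * exp (\<bar>\<mu>\<bar> * s)"
      by (simp add: abs_mult mult.commute)
  qed (use assms in \<open>auto intro!: continuous_intros cont\<close>)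
  then show ?thesis using Jf_diff[OF assms(1-3), of \<mu> \<sigma> v] by simp
qed

lemma Ifun_eq_Jf:
  assumes "\<delta> > 0" "ramp_slopes (D1 \<mu> \<sigma> \<delta> \<gamma>) (D2 \<mu> \<sigma> \<delta> \<gamma>)" "k \<in> {1, 2, 3}"
  shows "Ifun \<mu> \<sigma> a v \<delta> \<gamma> k =
    \<delta> * Jf \<mu> \<sigma> (prof k (D1 \<mu> \<sigma> \<delta> \<gamma>) (D2 \<mu> \<sigma> \<delta> \<gamma>) (v / \<delta>)) (v / \<delta>) (a + \<gamma> * \<delta>)"
proof -
  let ?pr = "prof k (D1 \<mu> \<sigma> \<delta> \<gamma>) (D2 \<mu> \<sigma> \<delta> \<gamma>) (v / \<delta>)"
  have "integral {- (a + \<gamma> * \<delta>)..0} (\<lambda>\<theta>. exp (- \<mu> * \<theta>) * eta k \<mu> \<sigma> \<delta> \<gamma> v \<theta>) =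
      integral {- (a + \<gamma> * \<delta>)..0} (\<lambda>\<theta>. \<delta> * (exp (- \<mu> * \<theta>) * ?pr \<theta>))"
    by (rule integral_spike[of "{0}"]) (use eta_eq_prof[OF assms] in auto)
  then show ?thesis using assms(1) by (simp add: Ifun_def Jf_def r_plus_def algebra_simps)
qed

section \<open>The threshold quantity \<open>P\<close>\<close>

lemma ramp_slopes_D:
  assumes "\<sigma> < 0" "0 \<le> \<delta>"
  shows "ramp_slopes (D1 \<mu> \<sigma> \<delta> \<gamma>) (D2 \<mu> \<sigma> \<delta> \<gamma>)"
proof
  have L: "0 < \<bar>\<mu>\<bar> + \<bar>\<sigma>\<bar>" using assms by simp
  have "0 \<le> (\<bar>\<mu>\<bar> + \<bar>\<sigma>\<bar>) * \<bar>\<gamma>\<bar> * \<delta>" using assms by simp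
  with L show D1: "0 < D1 \<mu> \<sigma> \<delta> \<gamma>" unfolding D1_def by (intro mult_pos_pos) auto
  have "0 \<le> \<bar>\<sigma> * \<gamma>\<bar> * \<delta>" "0 \<le> (\<bar>\<mu>\<bar> + \<bar>\<sigma>\<bar>) ^ 3 * \<bar>\<gamma>\<bar> * \<delta>" using assms by simp_all
  moreover have "0 < (D1 \<mu> \<sigma> \<delta> \<gamma>)\<^sup>2" using D1 by simp
  ultimately show "0 < D2 \<mu> \<sigma> \<delta> \<gamma>" unfolding D2_def by (intro mult_pos_pos) linarith+
qed

lemma D1_mono: "0 \<le> \<delta> \<Longrightarrow> \<delta> \<le> \<delta>' \<Longrightarrow> D1 \<mu> \<sigma> \<delta> \<gamma> \<le> D1 \<mu> \<sigma> \<delta>' \<gamma>"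
  unfolding D1_def by (intro mult_left_mono add_left_mono) auto

lemma D1_nonneg: "0 \<le> \<delta> \<Longrightarrow> 0 \<le> D1 \<mu> \<sigma> \<delta> \<gamma>"
  by (simp add: D1_def)

lemma D1_square_le_D2: "0 \<le> \<delta> \<Longrightarrow> (D1 \<mu> \<sigma> \<delta> \<gamma>)\<^sup>2 \<le> D2 \<mu> \<sigma> \<delta> \<gamma>"
proof -
  assume "0 \<le> \<delta>"
  then have "(D1 \<mu> \<sigma> \<delta> \<gamma>)\<^sup>2 * 1 \<le> D2 \<mu> \<sigma> \<delta> \<gamma>"
    unfolding D2_def by (intro mult_mono) simp_all
  then show ?thesis by simp
qed

lemma D2_mono:
  assumes "0 \<le> \<delta>" "\<delta> \<le> \<delta>'"
  shows "D2 \<mu> \<sigma> \<delta> \<gamma> \<le> D2 \<mu> \<sigma> \<delta>' \<gamma>"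
proof -
  have "(D1 \<mu> \<sigma> \<delta> \<gamma>)\<^sup>2 \<le> (D1 \<mu> \<sigma> \<delta>' \<gamma>)\<^sup>2"
    using assms by (intro power_mono D1_mono D1_nonneg)
  then show ?thesis
    unfolding D2_def using assms by (intro mult_mono add_mono) (simp_all add: mult_left_mono)
qed

context
  fixes \<mu> \<sigma> :: real
  assumes mu_sigma: "\<sigma> \<le> \<mu>" "\<sigma> < - \<mu>"
begin

lemma sigma_neg: "\<sigma> < 0"
  using mu_sigma by simp

lemma value_range: "- 1 \<le> - \<mu> / \<sigma>" "- \<mu> / \<sigma> < 1"
  using mu_sigma sigma_neg by (simp_all add: field_simps)

lemma scaled_value_range: "0 < \<delta> \<Longrightarrow> v / \<delta> \<in> {- 1..- \<mu> / \<sigma>} \<longleftrightarrow> v \<in> {- \<delta>..- \<delta> * \<mu> / \<sigma>}"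
  by (auto simp: pos_le_divide_eq pos_divide_le_eq mult.commute)

abbreviation norm_prof :: "nat \<Rightarrow> real \<Rightarrow> real \<Rightarrow> real \<Rightarrow> real \<Rightarrow> real" where
  "norm_prof k \<delta> \<gamma> \<equiv> prof k (D1 \<mu> \<sigma> \<delta> \<gamma>) (D2 \<mu> \<sigma> \<delta> \<gamma>)"

lemma Jf_prof_diff_le:
  assumes "ramp_slopes p q" "0 \<le> r" "r \<le> s" "v \<in> {- 1..- \<mu> / \<sigma>}"
  shows "\<bar>Jf \<mu> \<sigma> (prof k p q v) v s - Jf \<mu> \<sigma> (prof k p q v) v r\<bar>
    \<le> (\<bar>\<mu>\<bar> + \<bar>\<sigma>\<bar>) * exp (\<bar>\<mu>\<bar> * s) * (s - r)"
proof -
  interpret ramp_slopes p q by fact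
  show ?thesis
  proof (rule Jf_diff_le)
    show "\<bar>v\<bar> \<le> 1" using assms(4) value_range by auto
    then show "\<bar>prof k p q v \<theta>\<bar> \<le> 1" if "\<theta> \<in> {- s..0}" for \<theta>
      using prof_ge[of k v \<theta>] prof_le[of v \<theta> k] that by (simp add: abs_le_iff)
  qed (use assms continuous_on_prof in auto)
qed

context
  fixes a c \<delta> :: real and k :: nat
  assumes a: "0 < a" and delta: "0 < \<delta>" and k: "k \<in> {1, 2, 3}"
begin

lemma Ifun_eq_Jf':
  "Ifun \<mu> \<sigma> a (\<delta> * v) \<delta> \<bar>c\<bar> k = \<delta> * Jf \<mu> \<sigma> (norm_prof k \<delta> \<bar>c\<bar> v) v (a + \<bar>c\<bar> * \<delta>)"
  using Ifun_eq_Jf[OF delta ramp_slopes_D k, where v = "\<delta> * v"] sigma_neg delta by simp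

lemma Jf_le_Pfun:
  assumes "v \<in> {- 1..- \<mu> / \<sigma>}"
  shows "\<delta> * Jf \<mu> \<sigma> (norm_prof k \<delta> \<bar>c\<bar> v) v (a + \<bar>c\<bar> * \<delta>) \<le> Pfun \<mu> \<sigma> a \<delta> c k"
proof -
  let ?s = "a + \<bar>c\<bar> * \<delta>"
  have "bdd_above ((\<lambda>v. Ifun \<mu> \<sigma> a v \<delta> \<bar>c\<bar> k) ` {- \<delta>..- \<delta> * \<mu> / \<sigma>})"
  proof (rule bdd_aboveI2)
    fix w assume "w \<in> {- \<delta>..- \<delta> * \<mu> / \<sigma>}"
    then have w: "w / \<delta> \<in> {- 1..- \<mu> / \<sigma>}" using scaled_value_range delta by blast
    have "Jf \<mu> \<sigma> (norm_prof k \<delta> \<bar>c\<bar> (w / \<delta>)) (w / \<delta>) ?s \<le>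
        1 + (\<bar>\<mu>\<bar> + \<bar>\<sigma>\<bar>) * exp (\<bar>\<mu>\<bar> * ?s) * ?s"
      using abs_le_D1[OF Jf_prof_diff_le[OF ramp_slopes_D[OF sigma_neg, of \<delta> \<mu> "\<bar>c\<bar>"] order.refl _ w,
          where s = ?s and k = k]] a delta
        value_range w by auto
    then show "Ifun \<mu> \<sigma> a w \<delta> \<bar>c\<bar> k \<le> \<delta> * (1 + (\<bar>\<mu>\<bar> + \<bar>\<sigma>\<bar>) * exp (\<bar>\<mu>\<bar> * ?s) * ?s)"
      using Ifun_eq_Jf'[of "w / \<delta>"] delta by (simp add: mult_left_mono)
  qed
  moreover have "\<delta> * v \<in> {- \<delta>..- \<delta> * \<mu> / \<sigma>}"
    using scaled_value_range[OF delta, of "\<delta> * v"] assms delta by simp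
  ultimately have "Ifun \<mu> \<sigma> a (\<delta> * v) \<delta> \<bar>c\<bar> k \<le> Pfun \<mu> \<sigma> a \<delta> c k"
    unfolding Pfun_def by (intro cSUP_upper)
  then show ?thesis by (simp add: Ifun_eq_Jf')
qed

lemma Pfun_le:
  assumes "\<And>v. v \<in> {- 1..- \<mu> / \<sigma>} \<Longrightarrow> Jf \<mu> \<sigma> (norm_prof k \<delta> \<bar>c\<bar> v) v (a + \<bar>c\<bar> * \<delta>) \<le> B"
  shows "Pfun \<mu> \<sigma> a \<delta> c k \<le> \<delta> * B"
  unfolding Pfun_def
proof (rule cSUP_least)
  show "{- \<delta>..- \<delta> * \<mu> / \<sigma>} \<noteq> {}"
    using scaled_value_range[OF delta, of "- \<delta>"] value_range delta by auto
  fix w assume "w \<in> {- \<delta>..- \<delta> * \<mu> / \<sigma>}"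
  then have w: "w / \<delta> \<in> {- 1..- \<mu> / \<sigma>}" using scaled_value_range delta by blast
  show "Ifun \<mu> \<sigma> a w \<delta> \<bar>c\<bar> k \<le> \<delta> * B"
    using assms[OF w] Ifun_eq_Jf'[of "w / \<delta>"] delta by simp
qed

end

text \<open>Both slope parameters are dominated by those for \<open>\<gamma> = 0\<close> after rescaling the argument of
  the profile by \<open>(1 + (\<bar>\<mu>\<bar> + \<bar>\<sigma>\<bar>) * g)\<^sup>2\<close>, where \<open>g = \<gamma> * \<delta>\<close>.\<close>

lemma Jf_small_delay_perturbation:
  assumes "0 < a" "0 \<le> \<gamma>" "0 < \<delta>" and v: "v \<in> {- 1..- \<mu> / \<sigma>}"
  defines "L \<equiv> \<bar>\<mu>\<bar> + \<bar>\<sigma>\<bar>" and "g \<equiv> \<gamma> * \<delta>"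
  shows "Jf \<mu> \<sigma> (norm_prof k \<delta> \<gamma> v) v (a + g) \<le> Jf \<mu> \<sigma> (norm_prof k 1 0 v) v a
    + L * exp (\<bar>\<mu>\<bar> * (a + g)) * g
    + \<bar>\<sigma>\<bar> * (L * ((1 + L * g)\<^sup>2 - 1) * (a + g) * exp (\<bar>\<mu>\<bar> * (a + g)) * (a + g))"
proof -
  define x where "x = 1 + L * g"
  have L: "0 < L" using sigma_neg by (simp add: L_def)
  have g: "0 \<le> g" using assms by (simp add: g_def)
  have x1: "1 \<le> x" using L g by (simp add: x_def)
  then have x2: "1 \<le> x\<^sup>2" by simp
  have D0: "D1 \<mu> \<sigma> 1 0 = L" "D2 \<mu> \<sigma> 1 0 = L\<^sup>2" by (simp_all add: D1_def D2_def L_def)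
  have Dg: "D1 \<mu> \<sigma> \<delta> \<gamma> = L * x"
    using assms by (simp add: D1_def L_def x_def g_def mult.assoc)
  have "\<bar>\<sigma> * \<gamma>\<bar> * \<delta> \<le> L * g"
    using assms by (simp add: L_def g_def abs_mult mult.assoc mult_right_mono)
  then have "D2 \<mu> \<sigma> \<delta> \<gamma> \<le> ((L * x)\<^sup>2 + L ^ 3 * g) * x"
    unfolding D2_def Dg using assms L
    by (intro mult_mono) (auto simp: L_def g_def x_def mult.assoc)
  also have "\<dots> = L\<^sup>2 * ((x\<^sup>2 + (x - 1)) * x)"
    by (simp add: x_def power2_eq_square power3_eq_cube algebra_simps)
  also have "\<dots> \<le> L\<^sup>2 * (x ^ 3 * x)"
  proof -
    have "x ^ 3 - (x\<^sup>2 + (x - 1)) = (x - 1)\<^sup>2 * (x + 1)"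
      by (simp add: power2_eq_square power3_eq_cube algebra_simps)
    also have "\<dots> \<ge> 0" using x1 by simp
    finally show ?thesis using x1 by (intro mult_left_mono mult_right_mono) auto
  qed
  finally have D2g: "D2 \<mu> \<sigma> \<delta> \<gamma> \<le> (x\<^sup>2)\<^sup>2 * L\<^sup>2"
    by (simp add: power2_eq_square power3_eq_cube mult_ac)
  have D1g: "D1 \<mu> \<sigma> \<delta> \<gamma> \<le> x\<^sup>2 * L"
    using x1 L by (simp add: Dg power2_eq_square)
  interpret r0: ramp_slopes L "L\<^sup>2" using ramp_slopes_D[OF sigma_neg, of 1 \<mu> 0] by (simp add: D0)
  interpret rg: ramp_slopes "D1 \<mu> \<sigma> \<delta> \<gamma>" "D2 \<mu> \<sigma> \<delta> \<gamma>"
    using ramp_slopes_D[OF sigma_neg] assms by simp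
  have "Jf \<mu> \<sigma> (norm_prof k \<delta> \<gamma> v) v (a + g) \<le> Jf \<mu> \<sigma> (prof k L (L\<^sup>2) v) v (a + g)
      + \<bar>\<sigma>\<bar> * (L * (x\<^sup>2 - 1) * (a + g) * exp (\<bar>\<mu>\<bar> * (a + g)) * (a + g))"
  proof (rule Jf_perturb)
    fix \<theta> assume \<theta>: "\<theta> \<in> {- (a + g)..0}"
    have "x\<^sup>2 * \<theta> \<le> \<theta>" using \<theta> mult_right_mono_neg[OF x2, of \<theta>] by simp
    then have "prof k L (L\<^sup>2) v \<theta> \<le> prof k L (L\<^sup>2) v (x\<^sup>2 * \<theta>) + L * (\<theta> - x\<^sup>2 * \<theta>)"
      using r0.prof_lipschitz[of "x\<^sup>2 * \<theta>" \<theta> k v] by simp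
    also have "L * (\<theta> - x\<^sup>2 * \<theta>) = L * (x\<^sup>2 - 1) * (- \<theta>)" by (simp add: algebra_simps)
    also have "\<dots> \<le> L * (x\<^sup>2 - 1) * (a + g)"
      using \<theta> L x2 by (intro mult_left_mono) auto
    also have "prof k L (L\<^sup>2) v (x\<^sup>2 * \<theta>) = prof k (x\<^sup>2 * L) ((x\<^sup>2)\<^sup>2 * L\<^sup>2) v \<theta>"
      using x1 by (intro r0.prof_scale[symmetric]) simp
    also have "\<dots> \<le> norm_prof k \<delta> \<gamma> v \<theta>"
      using D1g D2g v \<theta> by (intro rg.prof_antimono) auto
    finally show "prof k L (L\<^sup>2) v \<theta> - L * (x\<^sup>2 - 1) * (a + g) \<le> norm_prof k \<delta> \<gamma> v \<theta>" by simp
  qed (use sigma_neg assms(1) g L x2 in \<open>simp_all add: r0.continuous_on_prof rg.continuous_on_prof\<close>)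
  moreover have "Jf \<mu> \<sigma> (prof k L (L\<^sup>2) v) v (a + g) \<le> Jf \<mu> \<sigma> (prof k L (L\<^sup>2) v) v a
      + L * exp (\<bar>\<mu>\<bar> * (a + g)) * g"
    using abs_le_D1[OF Jf_prof_diff_le[OF r0.ramp_slopes_axioms _ _ v, of a "a + g" k]] assms(1) g
    by (simp add: L_def)
  ultimately show ?thesis by (simp add: D0 x_def)
qed

lemma Pfun_less_small_delta:
  assumes a: "0 < a" and c: "c \<noteq> 0" and k: "k \<in> {1, 2, 3}" and P: "Pfun \<mu> \<sigma> a 1 0 k < 1"
  shows "\<exists>\<delta>. 0 < \<delta> \<and> \<delta> < \<bar>a / c\<bar> \<and> Pfun \<mu> \<sigma> a \<delta> c k < \<delta>"
proof -
  define L where "L = \<bar>\<mu>\<bar> + \<bar>\<sigma>\<bar>"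
  define err where "err \<delta> = L * exp (\<bar>\<mu>\<bar> * (a + \<bar>c\<bar> * \<delta>)) * (\<bar>c\<bar> * \<delta>) + \<bar>\<sigma>\<bar> * (L *
    ((1 + L * (\<bar>c\<bar> * \<delta>))\<^sup>2 - 1) * (a + \<bar>c\<bar> * \<delta>) * exp (\<bar>\<mu>\<bar> * (a + \<bar>c\<bar> * \<delta>)) * (a + \<bar>c\<bar> * \<delta>))" for \<delta>
  have "(err \<longlongrightarrow> err 0) (at_right 0)"
    unfolding err_def by (intro tendsto_intros)
  then have "(err \<longlongrightarrow> 0) (at_right 0)" by (simp add: err_def)
  then have "\<forall>\<^sub>F \<delta> in at_right 0. err \<delta> < 1 - Pfun \<mu> \<sigma> a 1 0 k"
    using P by (intro order_tendstoD) auto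
  moreover have "\<forall>\<^sub>F \<delta> in at_right 0. \<delta> < \<bar>a / c\<bar>"
    using eventually_at_right_real[of 0 "\<bar>a / c\<bar>"] a c by (auto elim: eventually_mono)
  moreover have "\<forall>\<^sub>F \<delta> in at_right (0::real). 0 < \<delta>" by (rule eventually_at_right_less)
  ultimately have "\<forall>\<^sub>F \<delta> in at_right 0. err \<delta> < 1 - Pfun \<mu> \<sigma> a 1 0 k \<and> \<delta> < \<bar>a / c\<bar> \<and> 0 < \<delta>"
    by eventually_elim auto
  then obtain \<delta> where \<delta>: "err \<delta> < 1 - Pfun \<mu> \<sigma> a 1 0 k" "\<delta> < \<bar>a / c\<bar>" "0 < \<delta>"
    using eventually_happens'[OF trivial_limit_at_right_real] by blast
  have "Pfun \<mu> \<sigma> a \<delta> c k \<le> \<delta> * (Pfun \<mu> \<sigma> a 1 0 k + err \<delta>)"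
  proof (rule Pfun_le[OF a \<delta>(3) k])
    fix v assume v: "v \<in> {- 1..- \<mu> / \<sigma>}"
    have "Jf \<mu> \<sigma> (norm_prof k 1 0 v) v a \<le> Pfun \<mu> \<sigma> a 1 0 k"
      using Jf_le_Pfun[OF a zero_less_one k v, of 0] by simp
    then show "Jf \<mu> \<sigma> (norm_prof k \<delta> \<bar>c\<bar> v) v (a + \<bar>c\<bar> * \<delta>) \<le> Pfun \<mu> \<sigma> a 1 0 k + err \<delta>"
      using Jf_small_delay_perturbation[OF a abs_ge_zero \<delta>(3) v, of k c]
      unfolding err_def L_def by linarith
  qed
  also have "\<dots> < \<delta> * 1" using \<delta> by (intro mult_strict_left_mono) auto
  finally show ?thesis using \<delta> by auto
qed

text \<open>The bound \<open>Pfun < \<delta>\<close> leaves a margin that absorbs small perturbations of the extremality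
  conditions \<open>x = 1\<close> and \<open>0 \<le> \<mu> * x + \<sigma> * v\<close>.\<close>

lemma Jf_margin:
  assumes a: "0 < a" and delta: "0 < \<delta>" and k: "k \<in> {1, 2, 3}" and P: "Pfun \<mu> \<sigma> a \<delta> c k < \<delta>"
  shows "\<exists>\<epsilon>. 0 < \<epsilon> \<and> \<epsilon> < 1 \<and> (\<forall>v x r. - 1 \<le> v \<and> 0 \<le> r \<and> r \<le> a + \<bar>c\<bar> * \<delta> \<and>
    x \<le> 1 \<and> 1 - \<epsilon> \<le> x \<and> - \<epsilon> \<le> \<mu> * x + \<sigma> * v \<longrightarrow>
    Jf \<mu> \<sigma> (norm_prof k \<delta> \<bar>c\<bar> v) v r < 1 - \<epsilon>)"
proof -
  define R where "R = a + \<bar>c\<bar> * \<delta>"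
  define \<kappa> where "\<kappa> = max (- \<mu> / \<sigma>) (Pfun \<mu> \<sigma> a \<delta> c k / \<delta>)"
  define C where "C = (1 + \<bar>\<mu>\<bar>) / (- \<sigma>) * exp (\<bar>\<mu>\<bar> * R)"
  interpret ramp_slopes "D1 \<mu> \<sigma> \<delta> \<bar>c\<bar>" "D2 \<mu> \<sigma> \<delta> \<bar>c\<bar>"
    using ramp_slopes_D[OF sigma_neg] delta by simp
  let ?pr = "norm_prof k \<delta> \<bar>c\<bar>"
  have C: "0 \<le> C" using sigma_neg by (simp add: C_def divide_nonneg_neg)
  have \<kappa>: "\<kappa> < 1" using P delta value_range by (simp add: \<kappa>_def)
  have "\<kappa> \<ge> - 1" using value_range by (simp add: \<kappa>_def)
  define \<epsilon> where "\<epsilon> = (1 - \<kappa>) / (3 + C)"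
  have \<epsilon>: "0 < \<epsilon>" "\<epsilon> < 1" using C \<kappa> \<open>\<kappa> \<ge> - 1\<close> by (simp_all add: \<epsilon>_def)
  have "(3 + C) * \<epsilon> = 1 - \<kappa>" using C by (simp add: \<epsilon>_def)
  then have margin: "\<kappa> + C * \<epsilon> < 1 - \<epsilon>" using \<epsilon> by (simp add: algebra_simps)
  have base: "Jf \<mu> \<sigma> (?pr v) v r \<le> \<kappa>" if "v \<in> {- 1..- \<mu> / \<sigma>}" "0 \<le> r" "r \<le> R" for v r
  proof -
    have "Jf \<mu> \<sigma> (?pr v) v r \<le> max v (Jf \<mu> \<sigma> (?pr v) v R)"
      using that sigma_neg by (intro Jf_le_max continuous_on_prof mono_prof) auto
    moreover have "Jf \<mu> \<sigma> (?pr v) v R \<le> Pfun \<mu> \<sigma> a \<delta> c k / \<delta>"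
      using Jf_le_Pfun[OF a delta k that(1), of c] delta
      by (simp add: R_def pos_le_divide_eq mult.commute)
    ultimately show ?thesis using that(1) by (auto simp: \<kappa>_def le_max_iff_disj)
  qed
  have "Jf \<mu> \<sigma> (?pr v) v r < 1 - \<epsilon>"
    if v: "- 1 \<le> v" and r: "0 \<le> r" "r \<le> R" and x: "x \<le> 1" "1 - \<epsilon> \<le> x"
      and d: "- \<epsilon> \<le> \<mu> * x + \<sigma> * v" for v x r
  proof -
    define w where "w = min v (- \<mu> / \<sigma>)"
    have w: "w \<in> {- 1..- \<mu> / \<sigma>}" using v value_range by (simp add: w_def)
    have "\<mu> * (x - 1) \<le> \<bar>\<mu>\<bar> * \<bar>x - 1\<bar>" by (metis abs_ge_self abs_mult)
    also have "\<dots> \<le> \<bar>\<mu>\<bar> * \<epsilon>" using x by (intro mult_left_mono) auto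
    finally have "- \<sigma> * v \<le> \<mu> + \<epsilon> * (1 + \<bar>\<mu>\<bar>)" using d by (simp add: algebra_simps)
    then have "v \<le> - \<mu> / \<sigma> + \<epsilon> * ((1 + \<bar>\<mu>\<bar>) / (- \<sigma>))"
      using sigma_neg by (simp add: field_simps)
    moreover have "0 \<le> \<epsilon> * ((1 + \<bar>\<mu>\<bar>) / (- \<sigma>))"
      using \<epsilon> sigma_neg by (simp add: divide_nonneg_neg)
    ultimately have vw: "w \<le> v" "v - w \<le> \<epsilon> * ((1 + \<bar>\<mu>\<bar>) / (- \<sigma>))" by (auto simp: w_def)
    have "Jf \<mu> \<sigma> (?pr v) v r \<le> Jf \<mu> \<sigma> (?pr w) v r + \<bar>\<sigma>\<bar> * (0 * exp (\<bar>\<mu>\<bar> * r) * r)"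
      using sigma_neg r w vw(1)
      by (intro Jf_perturb continuous_on_prof) (auto intro: mono_prof_value)
    also have "\<dots> = Jf \<mu> \<sigma> (?pr w) w r + (v - w) * exp (\<mu> * r)"
      by (simp add: Jf_def algebra_simps)
    also have "\<dots> \<le> \<kappa> + \<epsilon> * ((1 + \<bar>\<mu>\<bar>) / (- \<sigma>)) * exp (\<bar>\<mu>\<bar> * R)"
    proof (intro add_mono base w r mult_mono vw)
      have "\<mu> * r \<le> \<bar>\<mu>\<bar> * R" using r by (intro mult_mono) auto
      then show "exp (\<mu> * r) \<le> exp (\<bar>\<mu>\<bar> * R)" by simp
      show "0 \<le> \<epsilon> * ((1 + \<bar>\<mu>\<bar>) / (- \<sigma>))" by fact
    qed simp
    also have "\<dots> = \<kappa> + C * \<epsilon>" by (simp add: C_def)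
    finally show ?thesis using margin by simp
  qed
  then show ?thesis using \<epsilon> unfolding R_def by blast
qed

end

section \<open>Normalised bounded solutions\<close>

lemma slope_square_bound:
  fixes f f' :: "real \<Rightarrow> real"
  assumes q: "0 < q" and s: "r \<le> s"
    and f: "\<And>x. x \<in> {r..s} \<Longrightarrow> (f has_real_derivative f' x) (at x within {r..s})"
    and nonneg: "\<And>x. x \<in> {r..s} \<Longrightarrow> 0 \<le> f x"
    and curv: "\<And>x. x \<in> {r..s} \<Longrightarrow> f' s - f' x \<le> q * (s - x)"
    and start: "f' r \<le> 0 \<or> (f' r)\<^sup>2 \<le> 2 * q * f r \<or> f' s \<le> q * (s - r)"
  shows "f' s \<le> 0 \<or> (f' s)\<^sup>2 \<le> 2 * q * f s"
proof (cases "f' s \<le> 0")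
  case pos: False
  have low: "f x + f' s * (s - x) - q / 2 * (s - x)\<^sup>2 \<le> f s" if x: "x \<in> {r..s}" for x
  proof -
    let ?g = "\<lambda>y. f y + f' s * (s - y) - q / 2 * (s - y)\<^sup>2"
    have "?g x \<le> ?g s"
    proof (rule within_deriv_nonneg_imp_le[where f = ?g and f' = "\<lambda>y. f' y - f' s + q * (s - y)"])
      show "x \<le> s" using x by simp
      fix y assume y: "y \<in> {x..s}"
      have "(f has_real_derivative f' y) (at y within {x..s})"
        using f[of y] x y by (intro has_field_derivative_subset[OF f]) auto
      then show "(?g has_real_derivative f' y - f' s + q * (s - y)) (at y within {x..s})"
        by (auto intro!: derivative_eq_intros simp: field_simps)
      show "0 \<le> f' y - f' s + q * (s - y)" using curv[of y] x y by auto
    qed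
    then show ?thesis by simp
  qed
  have "(f' s)\<^sup>2 \<le> 2 * q * f s"
  proof (cases "f' s \<le> q * (s - r)")
    case True
    define x where "x = s - f' s / q"
    have sx: "s - x = f' s / q" by (simp add: x_def)
    have "f' s / q \<le> s - r" using True q by (simp add: field_simps)
    moreover have "0 \<le> f' s / q" using pos q by simp
    ultimately have "x \<in> {r..s}" by (simp add: x_def)
    from low[OF this] nonneg[OF this] have "f' s * (f' s / q) - q / 2 * (f' s / q)\<^sup>2 \<le> f s"
      unfolding sx by linarith
    then show ?thesis using q by (simp add: field_simps power2_eq_square)
  next
    case False
    have "f' s - q * (s - r) \<le> f' r" using curv[of r] s by auto
    moreover have "(f' s - q * (s - r)) \<ge> 0" using False by simp
    ultimately have "(f' s - q * (s - r))\<^sup>2 \<le> (f' r)\<^sup>2" "\<not> f' r \<le> 0"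
      using False by (auto intro: power_mono)
    then have "(f' s - q * (s - r))\<^sup>2 \<le> 2 * q * f r" using start False by linarith
    moreover have "2 * q * (f r + f' s * (s - r) - q / 2 * (s - r)\<^sup>2) \<le> 2 * q * f s"
      using q low[of r] s by (intro mult_left_mono) auto
    ultimately show ?thesis by (simp add: algebra_simps power2_eq_square)
  qed
  then show ?thesis ..
qed simp

text \<open>Solutions are normalised to \<open>\<bar>u\<bar> \<le> 1\<close>: if \<open>u\<close> solves the equation with parameter \<open>c\<close>, then
  \<open>u / M\<close> solves it with parameter \<open>c * M\<close>, for positive as well as for negative \<open>M\<close>.\<close>

locale bounded_dde =
  fixes \<mu> \<sigma> a c b t R :: real and u :: "real \<Rightarrow> real"
  assumes sigma: "\<sigma> < 0"
    and c_less: "\<bar>c\<bar> < a" and R_ge: "a + \<bar>c\<bar> \<le> R"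
    and bound: "\<And>s. s \<in> {b - R..t} \<Longrightarrow> \<bar>u s\<bar> \<le> 1"
    and dde: "\<And>s. s \<in> {b..t} \<Longrightarrow>
      (u has_real_derivative \<mu> * u s + \<sigma> * u (s - a - c * u s)) (at s within {b..t})"
begin

definition lag :: "real \<Rightarrow> real" where "lag s = s - a - c * u s"
definition w :: "real \<Rightarrow> real" where "w s = u (lag s)"
definition du :: "real \<Rightarrow> real" where "du s = \<mu> * u s + \<sigma> * w s"
definition dw :: "real \<Rightarrow> real" where "dw s = du (lag s) * (1 - c * du s)"
definition L :: real where "L = \<bar>\<mu>\<bar> + \<bar>\<sigma>\<bar>"
definition Q :: real where "Q = L * \<bar>c\<bar>"
definition d1 :: real where "d1 = L * (1 + Q)"
definition d2 :: real where "d2 = (d1\<^sup>2 + L\<^sup>2 * Q) * (1 + \<bar>\<sigma>\<bar> * \<bar>c\<bar>)"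

lemma L_pos: "0 < L" using sigma by (simp add: L_def)
lemma Q_nonneg: "0 \<le> Q" using L_pos by (simp add: Q_def)
lemma d1_pos: "0 < d1" using L_pos Q_nonneg by (auto simp: d1_def intro!: mult_pos_pos)
lemma R_pos: "0 < R" using c_less R_ge by linarith

lemma cu_le: "s \<in> {b - R..t} \<Longrightarrow> \<bar>c * u s\<bar> \<le> \<bar>c\<bar>"
  using bound[of s] by (simp add: abs_mult mult_left_le)

lemma lag_bounds: "s \<in> {b..t} \<Longrightarrow> s - R \<le> lag s \<and> lag s < s"
  using cu_le[of s] c_less R_ge R_pos by (auto simp: lag_def)

lemma w_bound: "s \<in> {b..t} \<Longrightarrow> \<bar>w s\<bar> \<le> 1"
  using bound[of "lag s"] lag_bounds[of s] by (auto simp: w_def)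

lemma du: "s \<in> {b..t} \<Longrightarrow> (u has_real_derivative du s) (at s within {b..t})"
  using dde[of s] by (simp add: du_def w_def lag_def)

lemma abs_du_le:
  assumes "\<bar>u s\<bar> \<le> e" "\<bar>w s\<bar> \<le> e"
  shows "\<bar>du s\<bar> \<le> L * e"
proof -
  have "\<bar>du s\<bar> \<le> \<bar>\<mu>\<bar> * \<bar>u s\<bar> + \<bar>\<sigma>\<bar> * \<bar>w s\<bar>"
    unfolding du_def by (metis abs_mult abs_triangle_ineq)
  also have "\<dots> \<le> \<bar>\<mu>\<bar> * e + \<bar>\<sigma>\<bar> * e" using assms by (intro add_mono mult_left_mono) auto
  finally show ?thesis by (simp add: L_def algebra_simps)
qed

lemma du_bound: "s \<in> {b..t} \<Longrightarrow> \<bar>du s\<bar> \<le> L"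
  using abs_du_le[of s 1] w_bound[of s] bound[of s] R_pos by auto

lemma cdu_bound: "s \<in> {b..t} \<Longrightarrow> \<bar>c * du s\<bar> \<le> Q"
  using mult_left_mono[OF du_bound abs_ge_zero, of s c] by (simp add: abs_mult Q_def mult.commute)

lemma u_lipschitz: "x \<in> {b..t} \<Longrightarrow> y \<in> {b..t} \<Longrightarrow> \<bar>u x - u y\<bar> \<le> L * \<bar>x - y\<bar>"
  using field_differentiable_bound[of "{b..t}" u du L x y] du du_bound by simp

lemma lag_deriv: "s \<in> {b..t} \<Longrightarrow> (lag has_real_derivative 1 - c * du s) (at s within {b..t})"
  unfolding lag_def[abs_def] by (auto intro!: derivative_eq_intros du)

lemma lag_slope: "s \<in> {b..t} \<Longrightarrow> \<bar>1 - c * du s\<bar> \<le> 1 + Q"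
  using cdu_bound[of s] by auto

lemma lag_lipschitz:
  "x \<in> {b..t} \<Longrightarrow> y \<in> {b..t} \<Longrightarrow> \<bar>lag x - lag y\<bar> \<le> (1 + Q) * \<bar>x - y\<bar>"
  using field_differentiable_bound[of "{b..t}" lag "\<lambda>s. 1 - c * du s" "1 + Q" x y] lag_deriv lag_slope
  by simp

lemma lag_in: "s \<in> {b + R..t} \<Longrightarrow> lag s \<in> {b..t}"
  using lag_bounds[of s] R_pos by auto

lemma dw: "s \<in> {b + R..t} \<Longrightarrow> (w has_real_derivative dw s) (at s within {b + R..t})"
proof -
  assume s: "s \<in> {b + R..t}"
  have "(lag has_real_derivative 1 - c * du s) (at s within {b + R..t})"
    using s R_pos by (intro has_field_derivative_subset[OF lag_deriv]) auto
  moreover have "(u has_real_derivative du (lag s)) (at (lag s) within lag ` {b + R..t})"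
    using s lag_in by (intro has_field_derivative_subset[OF du]) auto
  ultimately have "(u \<circ> lag has_real_derivative du (lag s) * (1 - c * du s)) (at s within {b + R..t})"
    by (rule DERIV_image_chain[rotated])
  then show ?thesis by (simp add: w_def[abs_def] dw_def o_def)
qed

lemma abs_dw_le:
  assumes "s \<in> {b + R..t}" "\<bar>du (lag s)\<bar> \<le> L * e"
  shows "\<bar>dw s\<bar> \<le> d1 * e"
proof -
  have "\<bar>dw s\<bar> \<le> (L * e) * (1 + Q)"
    unfolding dw_def abs_mult using assms R_pos
    by (intro mult_mono lag_slope) auto
  then show ?thesis by (simp add: d1_def mult_ac)
qed

lemma dw_bound: "s \<in> {b + R..t} \<Longrightarrow> \<bar>dw s\<bar> \<le> d1"
  using abs_dw_le[of s 1] du_bound[OF lag_in] by auto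

lemma w_lipschitz: "x \<in> {b + R..t} \<Longrightarrow> y \<in> {b + R..t} \<Longrightarrow> \<bar>w x - w y\<bar> \<le> d1 * \<bar>x - y\<bar>"
  using field_differentiable_bound[of "{b + R..t}" w dw d1 x y] dw dw_bound by simp

lemma du_lipschitz:
  assumes "x \<in> {b + R..t}" "y \<in> {b + R..t}"
  shows "\<bar>du x - du y\<bar> \<le> L\<^sup>2 * (1 + \<bar>\<sigma>\<bar> * \<bar>c\<bar>) * \<bar>x - y\<bar>"
proof -
  have "du x - du y = \<mu> * (u x - u y) + \<sigma> * (w x - w y)" by (simp add: du_def algebra_simps)
  then have "\<bar>du x - du y\<bar> \<le> \<bar>\<mu>\<bar> * \<bar>u x - u y\<bar> + \<bar>\<sigma>\<bar> * \<bar>w x - w y\<bar>"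
    by (metis abs_mult abs_triangle_ineq)
  also have "\<dots> \<le> \<bar>\<mu>\<bar> * (L * \<bar>x - y\<bar>) + \<bar>\<sigma>\<bar> * (d1 * \<bar>x - y\<bar>)"
    using assms R_pos by (intro add_mono mult_left_mono u_lipschitz w_lipschitz) auto
  also have "\<dots> = L\<^sup>2 * (1 + \<bar>\<sigma>\<bar> * \<bar>c\<bar>) * \<bar>x - y\<bar>"
  proof -
    have "\<bar>\<mu>\<bar> = L - \<bar>\<sigma>\<bar>" by (simp add: L_def)
    then have "\<bar>\<mu>\<bar> * (L * z) + \<bar>\<sigma>\<bar> * (d1 * z) = L\<^sup>2 * (1 + \<bar>\<sigma>\<bar> * \<bar>c\<bar>) * z" for z
      by (simp only: d1_def Q_def) (simp add: algebra_simps power2_eq_square)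
    then show ?thesis .
  qed
  finally show ?thesis .
qed

lemma dw_lipschitz:
  assumes x: "x \<in> {b + 2 * R..t}" and y: "y \<in> {b + 2 * R..t}"
  shows "\<bar>dw x - dw y\<bar> \<le> d2 * \<bar>x - y\<bar>"
proof -
  define K where "K = L\<^sup>2 * (1 + \<bar>\<sigma>\<bar> * \<bar>c\<bar>)"
  have K: "0 \<le> K" by (simp add: K_def)
  have lag: "lag x \<in> {b + R..t}" "lag y \<in> {b + R..t}"
    using lag_bounds[of x] lag_bounds[of y] x y R_pos by auto
  have "dw x - dw y = (du (lag x) - du (lag y)) * (1 - c * du x) - du (lag y) * (c * (du x - du y))"
    by (simp add: dw_def algebra_simps)
  then have "\<bar>dw x - dw y\<bar> \<le>
      \<bar>du (lag x) - du (lag y)\<bar> * \<bar>1 - c * du x\<bar> + \<bar>du (lag y)\<bar> * (\<bar>c\<bar> * \<bar>du x - du y\<bar>)"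
    using abs_triangle_ineq4[of "(du (lag x) - du (lag y)) * (1 - c * du x)"
        "du (lag y) * (c * (du x - du y))"] by (simp add: abs_mult)
  also have "\<dots> \<le> (K * ((1 + Q) * \<bar>x - y\<bar>)) * (1 + Q) + L * (\<bar>c\<bar> * (K * \<bar>x - y\<bar>))"
  proof (intro add_mono mult_mono lag_slope)
    have "\<bar>du (lag x) - du (lag y)\<bar> \<le> K * \<bar>lag x - lag y\<bar>"
      using du_lipschitz[OF lag] by (simp add: K_def)
    also have "\<dots> \<le> K * ((1 + Q) * \<bar>x - y\<bar>)"
      using x y R_pos K by (intro mult_left_mono lag_lipschitz) auto
    finally show "\<bar>du (lag x) - du (lag y)\<bar> \<le> K * ((1 + Q) * \<bar>x - y\<bar>)" .
    show "\<bar>du (lag y)\<bar> \<le> L" using lag R_pos by (intro du_bound) auto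
    show "\<bar>du x - du y\<bar> \<le> K * \<bar>x - y\<bar>"
      unfolding K_def using x y R_pos by (intro du_lipschitz) auto
    show "x \<in> {b..t}" using x R_pos by auto
  qed (use K Q_nonneg L_pos in auto)
  also have "\<dots> = (((1 + Q)\<^sup>2 + Q) * K) * \<bar>x - y\<bar>"
    unfolding Q_def by (simp only: power2_eq_square distrib_right distrib_left mult_ac)
  also have "((1 + Q)\<^sup>2 + Q) * K = d2"
  proof -
    have "((1 + Q)\<^sup>2 + Q) * (L\<^sup>2 * e) = ((L * (1 + Q))\<^sup>2 + L\<^sup>2 * Q) * e" for e
      by algebra
    then show ?thesis unfolding d2_def d1_def K_def .
  qed
  finally show ?thesis .
qed

lemma variation_of_constants:
  assumes t: "b + R \<le> t"
  defines "\<tau> \<equiv> a + c * u t"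
  shows "((\<lambda>\<theta>. exp (- \<mu> * \<theta>) * (\<sigma> * w (t + \<theta>))) has_integral u t - exp (\<mu> * \<tau>) * w t) {- \<tau>..0}"
    and "0 < \<tau>" and "\<tau> \<le> R"
proof -
  show \<tau>: "0 < \<tau>" "\<tau> \<le> R" using cu_le[of t] c_less R_ge R_pos t by (auto simp: \<tau>_def)
  have "((\<lambda>\<theta>. exp (- \<mu> * \<theta>) * (\<sigma> * w (t + \<theta>))) has_integral
      exp (- \<mu> * 0) * u (t + 0) - exp (- \<mu> * (- \<tau>)) * u (t + (- \<tau>))) {- \<tau>..0}"
  proof (rule fundamental_theorem_of_calculus)
    fix \<theta> assume \<theta>: "\<theta> \<in> {- \<tau>..0}"
    have "(u has_real_derivative du (t + \<theta>)) (at (t + \<theta>) within (+) t ` {- \<tau>..0})"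
      using \<theta> \<tau> t by (intro has_field_derivative_subset[OF du]) auto
    then have "((\<lambda>\<theta>. u (t + \<theta>)) has_real_derivative du (t + \<theta>)) (at \<theta> within {- \<tau>..0})"
      using DERIV_image_chain[of u "du (t + \<theta>)" "\<lambda>\<theta>. t + \<theta>" \<theta> "{- \<tau>..0}" 1]
        DERIV_add[OF DERIV_const DERIV_ident, of t \<theta> "{- \<tau>..0}"] by (simp add: o_def)
    then have "((\<lambda>\<theta>. exp (- \<mu> * \<theta>) * u (t + \<theta>)) has_real_derivative
        exp (- \<mu> * \<theta>) * (\<sigma> * w (t + \<theta>))) (at \<theta> within {- \<tau>..0})"
      by (auto intro!: derivative_eq_intros simp: du_def algebra_simps)
    then show "((\<lambda>\<theta>. exp (- \<mu> * \<theta>) * u (t + \<theta>)) has_vector_derivative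
        exp (- \<mu> * \<theta>) * (\<sigma> * w (t + \<theta>))) (at \<theta> within {- \<tau>..0})"
      by (simp add: has_real_derivative_iff_has_vector_derivative)
  qed (use \<tau> in simp)
  moreover have "t - \<tau> = lag t" by (simp add: lag_def \<tau>_def)
  ultimately show "((\<lambda>\<theta>. exp (- \<mu> * \<theta>) * (\<sigma> * w (t + \<theta>))) has_integral
      u t - exp (\<mu> * \<tau>) * w t) {- \<tau>..0}"
    by (simp add: w_def)
qed

lemma u_le_Jf:
  assumes t: "b + R \<le> t" and cont: "continuous_on UNIV \<eta>"
    and hist: "\<And>\<theta>. \<theta> \<in> {- R..0} \<Longrightarrow> \<eta> \<theta> \<le> w (t + \<theta>)"
  shows "u t \<le> Jf \<mu> \<sigma> \<eta> (w t) (a + c * u t)"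
proof -
  let ?\<tau> = "a + c * u t"
  note voc = variation_of_constants[OF t]
  have int: "(\<lambda>\<theta>. exp (- \<mu> * \<theta>) * \<eta> \<theta>) integrable_on {- ?\<tau>..0}"
    by (intro integrable_continuous_real continuous_intros continuous_on_subset[OF cont]) auto
  have "u t - exp (\<mu> * ?\<tau>) * w t \<le> \<sigma> * integral {- ?\<tau>..0} (\<lambda>\<theta>. exp (- \<mu> * \<theta>) * \<eta> \<theta>)"
  proof (rule has_integral_le[OF voc(1)])
    show "((\<lambda>\<theta>. \<sigma> * (exp (- \<mu> * \<theta>) * \<eta> \<theta>)) has_integral
        \<sigma> * integral {- ?\<tau>..0} (\<lambda>\<theta>. exp (- \<mu> * \<theta>) * \<eta> \<theta>)) {- ?\<tau>..0}"
      using int by (intro has_integral_mult_right integrable_integral)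
    fix \<theta> assume "\<theta> \<in> {- ?\<tau>..0}"
    then have "exp (- \<mu> * \<theta>) * \<eta> \<theta> \<le> exp (- \<mu> * \<theta>) * w (t + \<theta>)"
      using voc hist by (intro mult_left_mono) auto
    then show "exp (- \<mu> * \<theta>) * (\<sigma> * w (t + \<theta>)) \<le> \<sigma> * (exp (- \<mu> * \<theta>) * \<eta> \<theta>)"
      using sigma mult_left_mono_neg[of "exp (- \<mu> * \<theta>) * \<eta> \<theta>" "exp (- \<mu> * \<theta>) * w (t + \<theta>)" \<sigma>]
      by (simp add: mult_ac)
  qed
  then show ?thesis by (simp add: Jf_def mult.commute)
qed

context
  fixes p q :: real
  assumes d1_le: "d1 \<le> p" and d2_le: "d2 \<le> q" and q_pos: "0 < q"
begin

interpretation ramp_slopes p q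
  using d1_le d1_pos q_pos by unfold_locales auto

lemma prof_1_le_w: "b + R \<le> t \<Longrightarrow> \<theta> \<in> {- R..0} \<Longrightarrow> prof 1 p q v \<theta> \<le> w (t + \<theta>)"
  using w_bound[of "t + \<theta>"] by (auto simp: prof_def)

lemma w_ge_line: "b + 2 * R \<le> t \<Longrightarrow> \<theta> \<in> {- R..0} \<Longrightarrow> w t + p * \<theta> \<le> w (t + \<theta>)"
proof -
  assume *: "b + 2 * R \<le> t" "\<theta> \<in> {- R..0}"
  then have "\<bar>w t - w (t + \<theta>)\<bar> \<le> d1 * \<bar>t - (t + \<theta>)\<bar>" using R_pos by (intro w_lipschitz) auto
  also have "\<dots> \<le> p * \<bar>t - (t + \<theta>)\<bar>" using d1_le by (intro mult_right_mono) auto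
  finally show ?thesis using * by (simp add: abs_le_iff)
qed

lemma prof_2_le_w: "b + 2 * R \<le> t \<Longrightarrow> \<theta> \<in> {- R..0} \<Longrightarrow> prof 2 p q (w t) \<theta> \<le> w (t + \<theta>)"
  using w_ge_line[of \<theta>] w_bound[of "t + \<theta>"] R_pos by (auto simp: prof_def)

lemma prof_3_le_w:
  assumes t: "b + 3 * R \<le> t" and \<theta>: "\<theta> \<in> {- R..0}"
    and start: "dw (b + 2 * R) \<le> 0 \<or> (dw (b + 2 * R))\<^sup>2 \<le> 2 * q * (w (b + 2 * R) + 1) \<or>
      p \<le> q * (t - R - (b + 2 * R))"
  shows "prof 3 p q (w t) \<theta> \<le> w (t + \<theta>)"
proof -
  have deriv: "((\<lambda>x. w x + 1) has_real_derivative dw x) (at x within {y..z})"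
    if "x \<in> {y..z}" "{y..z} \<subseteq> {b + 2 * R..t}" for x y z
  proof -
    have "(w has_real_derivative dw x) (at x within {y..z})"
      using that R_pos by (intro has_field_derivative_subset[OF dw]) (auto dest: subsetD)
    then show ?thesis by (auto intro!: derivative_eq_intros)
  qed
  have curv: "dw x - dw y \<le> q * (x - y)" if "y \<le> x" "b + 2 * R \<le> y" "x \<le> t" for x y
  proof -
    have "dw x - dw y \<le> d2 * \<bar>x - y\<bar>" using dw_lipschitz[of x y] that by auto
    also have "\<dots> \<le> q * (x - y)" using that d2_le by (auto intro: mult_right_mono)
    finally show ?thesis .
  qed
  have slope: "dw s \<le> p" if "s \<in> {b + 2 * R..t}" for s
    using dw_bound[of s] that R_pos d1_le by (auto simp: abs_le_iff)
  have nonneg: "0 \<le> w s + 1" if "s \<in> {b + 2 * R..t}" for s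
    using w_bound[of s] that R_pos by (auto simp: abs_le_iff)
  let ?s = "t + \<theta>"
  have s: "b + 2 * R \<le> ?s" "?s \<le> t" using t \<theta> by auto
  have "dw ?s \<le> 0 \<or> (dw ?s)\<^sup>2 \<le> 2 * q * (w ?s + 1)"
  proof (rule slope_square_bound[OF q_pos s(1)])
    have "q * (t - R - (b + 2 * R)) \<le> q * (?s - (b + 2 * R))"
      using \<theta> q_pos by (intro mult_left_mono) auto
    then show "dw (b + 2 * R) \<le> 0 \<or> (dw (b + 2 * R))\<^sup>2 \<le> 2 * q * (w (b + 2 * R) + 1) \<or>
        dw ?s \<le> q * (?s - (b + 2 * R))"
      using start slope[of ?s] s by auto
  qed (use s deriv curv nonneg in auto)
  then have "ramp p q (ramp_inv p q (w (?s + (- \<theta>)) + 1) - (- \<theta>)) \<le> w ?s + 1"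
    by (intro ramp_comparison) (use s \<theta> deriv curv nonneg slope in auto)
  then show ?thesis by (simp add: prof_def)
qed

end

end

lemma continuous_bootstrap:
  fixes f g :: "real \<Rightarrow> real"
  assumes cont: "continuous_on {b..t} f" "continuous_on {b..t} g" and start: "f b < g b"
    and step: "\<And>x. x \<in> {b..t} \<Longrightarrow> (\<And>y. y \<in> {b..x} \<Longrightarrow> f y \<le> g y) \<Longrightarrow> f x < g x"
    and x: "x \<in> {b..t}"
  shows "f x < g x"
proof (rule ccontr)
  assume "\<not> f x < g x"
  define Z where "Z = {y \<in> {b..t}. g y \<le> f y}"
  have "closed Z"
    unfolding Z_def using cont by (intro continuous_on_closed_Collect_le) auto
  moreover have "x \<in> Z" using x \<open>\<not> f x < g x\<close> by (simp add: Z_def)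
  moreover have bdd: "bdd_below Z" by (rule bdd_belowI[of _ b]) (auto simp: Z_def)
  ultimately have inf: "Inf Z \<in> Z" by (intro closed_contains_Inf) auto
  let ?z = "Inf Z"
  have z: "b \<le> ?z" "?z \<le> t" "g ?z \<le> f ?z" using inf by (auto simp: Z_def)
  have "\<exists>y\<ge>b. y \<le> ?z \<and> f y - g y = 0"
    using start z
    by (intro IVT') (auto intro!: continuous_intros continuous_on_subset[OF cont(1)]
        continuous_on_subset[OF cont(2)])
  then obtain y where y: "b \<le> y" "y \<le> ?z" "f y = g y" by auto
  then have "y \<in> Z" using z by (simp add: Z_def)
  then have "y = ?z" using cInf_lower[OF _ bdd] y by force
  have "f y' \<le> g y'" if "y' \<in> {b..?z}" for y'
  proof (cases "y' = ?z")
    case False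
    then have "y' \<notin> Z" using cInf_lower[OF _ bdd, of y'] that by force
    then show ?thesis using that z by (simp add: Z_def)
  qed (use y \<open>y = ?z\<close> in simp)
  then show False using step[of ?z] z by force
qed

context bounded_dde
begin

lemma continuous_on_u: "continuous_on {b..t} u"
  by (rule DERIV_continuous_on[OF du])

lemma growth_bound:
  assumes init: "\<And>s. s \<in> {b - R..b} \<Longrightarrow> \<bar>u s\<bar> < B" and s: "s \<in> {b..t}"
  shows "\<bar>u s\<bar> < B * exp (L * (s - b))"
proof (rule continuous_bootstrap[OF _ _ _ _ s])
  have B: "0 < B" using init[of b] R_pos by auto
  show "continuous_on {b..t} (\<lambda>s. \<bar>u s\<bar>)" "continuous_on {b..t} (\<lambda>s. B * exp (L * (s - b)))"
    using continuous_on_u by (auto intro!: continuous_intros)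
  show "\<bar>u b\<bar> < B * exp (L * (b - b))" using init[of b] R_pos by simp
  fix x assume x: "x \<in> {b..t}" and le: "\<And>y. y \<in> {b..x} \<Longrightarrow> \<bar>u y\<bar> \<le> B * exp (L * (y - b))"
  show "\<bar>u x\<bar> < B * exp (L * (x - b))"
  proof (cases "x = b")
    case True
    then show ?thesis using init[of b] R_pos by simp
  next
    case False
    have slope: "\<bar>du y\<bar> \<le> L * (B * exp (L * (y - b)))" if y: "y \<in> {b..x}" for y
    proof (rule abs_du_le[OF le[OF y]])
      have lag: "y - R \<le> lag y" "lag y < y" using lag_bounds[of y] y x by auto
      have mono: "B * exp (L * (max b (lag y) - b)) \<le> B * exp (L * (y - b))"
        using B L_pos lag y by (intro mult_left_mono) auto
      show "\<bar>w y\<bar> \<le> B * exp (L * (y - b))"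
      proof (cases "b \<le> lag y")
        case True
        then show ?thesis using le[of "lag y"] lag y mono by (auto simp: w_def max_def)
      next
        case False
        then show ?thesis
          using init[of "lag y"] lag y mono by (auto simp: w_def max_def)
      qed
    qed
    have "norm (u x - u b) \<le> B * exp (L * (x - b)) - B * exp (L * (b - b))"
    proof (rule differentiable_bound_general[where f' = du])
      show "b < x" using x False by simp
      show "continuous_on {b..x} u" using x by (intro continuous_on_subset[OF continuous_on_u]) auto
      show "continuous_on {b..x} (\<lambda>s. B * exp (L * (s - b)))" by (intro continuous_intros)
      fix y assume y: "b < y" "y < x"
      then show "(u has_vector_derivative du y) (at y)"
        using du[of y] x at_within_Icc_at[of b y t]
        by (simp add: has_real_derivative_iff_has_vector_derivative)
      show "((\<lambda>s. B * exp (L * (s - b))) has_vector_derivative L * (B * exp (L * (y - b)))) (at y)"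
        unfolding has_real_derivative_iff_has_vector_derivative[symmetric]
        by (auto intro!: derivative_eq_intros)
      show "norm (du y) \<le> L * (B * exp (L * (y - b)))" using slope[of y] y by simp
    qed
    then have "\<bar>u x\<bar> \<le> \<bar>u b\<bar> + (B * exp (L * (x - b)) - B)" by simp
    then show ?thesis using init[of b] R_pos by simp
  qed
qed

context
  fixes p q \<epsilon> :: real and k :: nat
  assumes d1_le: "d1 \<le> p" and d2_le: "d2 \<le> q" and q_pos: "0 < q"
    and p_sq: "p\<^sup>2 \<le> q" and k: "k \<in> {1, 2, 3}" and eps: "0 < \<epsilon>"
    and margin: "\<And>v x r. - 1 \<le> v \<Longrightarrow> 0 \<le> r \<Longrightarrow> r \<le> R \<Longrightarrow> x \<le> 1 \<Longrightarrow> 1 - \<epsilon> \<le> x \<Longrightarrow>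
      - \<epsilon> \<le> \<mu> * x + \<sigma> * v \<Longrightarrow> Jf \<mu> \<sigma> (prof k p q v) v r < 1 - \<epsilon>"
begin

interpretation ramp_slopes p q
  using d1_le d1_pos q_pos by unfold_locales auto

lemma steep_descent:
  assumes t: "b + R \<le> t" and high: "1 - \<epsilon> \<le> u t"
    and hist: "\<And>\<theta>. \<theta> \<in> {- R..0} \<Longrightarrow> prof k p q (w t) \<theta> \<le> w (t + \<theta>)"
  shows "du t < - \<epsilon>"
proof (rule ccontr)
  assume "\<not> du t < - \<epsilon>"
  moreover have "t \<in> {b..t}" using t R_pos by auto
  ultimately have "Jf \<mu> \<sigma> (prof k p q (w t)) (w t) (a + c * u t) < 1 - \<epsilon>"
    using w_bound[of t] bound[of t] variation_of_constants(2,3)[OF t] high R_pos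
    by (intro margin) (auto simp: du_def abs_le_iff)
  moreover have "u t \<le> Jf \<mu> \<sigma> (prof k p q (w t)) (w t) (a + c * u t)"
    by (intro u_le_Jf t continuous_on_prof hist)
  ultimately show False using high by simp
qed

lemma late_steep_descent:
  assumes "b + 3 * R + p / q \<le> t" "1 - \<epsilon> \<le> u t"
  shows "du t < - \<epsilon>"
proof -
  have "0 < p / q" using p_pos q_pos by simp
  then have t: "b + 3 * R \<le> t" "b + 2 * R \<le> t" "b + R \<le> t" using assms R_pos by auto
  have "p \<le> q * (t - R - (b + 2 * R))" using assms q_pos by (simp add: field_simps)
  then show ?thesis
    using assms(2) k t d1_le d2_le q_pos prof_1_le_w[of p q] prof_2_le_w[of p q] prof_3_le_w[of p q]
    by (intro steep_descent) auto
qed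

text \<open>For \<open>k = 3\<close> the comparison needs a start at \<open>b + 2 * R\<close>. If \<open>L * R\<close> is not small, the
  solution is still small there by the growth bound; otherwise the solution varies so little over
  one delay that only the linear part of the profile matters.\<close>

lemma touching_history:
  assumes p_le: "p \<le> L * (1 + L * R)" and t: "b + real k * R \<le> t"
    and growth: "\<And>s. s \<in> {b..t} \<Longrightarrow> \<bar>u s\<bar> \<le> exp (L * (s - b - real k * R))"
    and ut: "u t = 1" and \<theta>: "\<theta> \<in> {- R..0}"
  shows "prof k p q (w t) \<theta> \<le> w (t + \<theta>)"
proof -
  consider "k = 1" | "k = 2" | "k = 3" "1 / 2 \<le> L * R" | "k = 3" "L * R < 1 / 2"
    using k by fastforce
  then show ?thesis
  proof cases
    case 1
    then show ?thesis using prof_1_le_w[OF d1_le d2_le q_pos] t \<theta> by simp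
  next
    case 2
    then show ?thesis using prof_2_le_w[OF d1_le d2_le q_pos] t \<theta> by simp
  next
    case 3
    define e where "e = exp (- (L * R))"
    define s where "s = b + 2 * R"
    have e0: "0 < e" by (simp add: e_def)
    have "3 / 2 \<le> exp (L * R)" using exp_ge_add_one_self[of "L * R"] 3 by linarith
    then have e: "e \<le> 2 / 3" by (simp add: e_def exp_minus field_simps)
    have s: "s \<in> {b + R..t}" using 3 t R_pos by (auto simp: s_def)
    have s': "s \<in> {b..t}" using s R_pos by auto
    have small: "\<bar>u x\<bar> \<le> e" if "x \<in> {b..s}" for x
    proof -
      have "\<bar>u x\<bar> \<le> exp (L * (x - b - real k * R))" using growth[of x] that s' by auto
      also have "\<dots> \<le> exp (L * (- R))"
        using that 3 L_pos by (subst exp_le_cancel_iff, intro mult_left_mono) (auto simp: s_def)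
      finally show ?thesis by (simp add: e_def)
    qed
    have lag: "lag s \<in> {b + R..s}" using lag_bounds[OF s'] by (auto simp: s_def)
    then have lag': "lag s \<in> {b..t}" using s R_pos by auto
    have lag2: "lag (lag s) \<in> {b..s}" using lag_bounds[OF lag'] lag by auto
    have ws: "\<bar>w s\<bar> \<le> e" using small[of "lag s"] lag R_pos by (auto simp: w_def)
    have "\<bar>du (lag s)\<bar> \<le> L * e"
      using small[of "lag s"] small[OF lag2] lag R_pos by (intro abs_du_le) (auto simp: w_def)
    then have "\<bar>dw s\<bar> \<le> d1 * e" by (intro abs_dw_le s)
    also have "\<dots> \<le> p * e" using d1_le e0 by simp
    finally have "(dw s)\<^sup>2 \<le> (p * e)\<^sup>2" using p_pos e0 by (intro abs_le_square_iff[THEN iffD1]) simp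
    also have "\<dots> \<le> q * e\<^sup>2" using p_sq by (simp add: power_mult_distrib mult_right_mono)
    also have "\<dots> \<le> q * (2 * (1 - e))"
    proof -
      have "e * e \<le> 2 / 3 * (2 / 3)" using e e0 by (intro mult_mono) auto
      then show ?thesis using e q_pos by (intro mult_left_mono) (auto simp: power2_eq_square)
    qed
    also have "\<dots> \<le> q * (2 * (w s + 1))" using ws q_pos by (intro mult_left_mono) auto
    finally have "(dw (b + 2 * R))\<^sup>2 \<le> 2 * q * (w (b + 2 * R) + 1)" by (simp add: s_def mult_ac)
    then show ?thesis using prof_3_le_w[OF d1_le d2_le q_pos] t \<theta> 3 by simp
  next
    case 4
    have tb: "t \<in> {b..t}" "b + R \<le> t" "b + 2 * R \<le> t" using t 4 R_pos by auto
    have "\<bar>u t - u (lag t)\<bar> \<le> L * \<bar>t - lag t\<bar>"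
      using lag_bounds[OF tb(1)] tb R_pos by (intro u_lipschitz) auto
    also have "\<dots> \<le> L * R" using lag_bounds[OF tb(1)] L_pos by (intro mult_left_mono) auto
    finally have wt: "1 - L * R \<le> w t" by (simp add: ut w_def abs_le_iff)
    have "p * R \<le> L * (1 + L * R) * R" using p_le R_pos by (intro mult_right_mono) auto
    also have "\<dots> = L * R * (1 + L * R)" by simp
    also have "\<dots> \<le> 1 / 2 * (3 / 2)"
      using 4 L_pos R_pos by (intro mult_mono) auto
    finally have pR: "p * R \<le> 3 / 4" by simp
    have half: "p\<^sup>2 / (2 * q) \<le> 1 / 2" using p_sq q_pos by (simp add: field_simps)
    let ?z = "ramp_inv p q (w t + 1)"
    have z: "?z = (w t + 1 + p\<^sup>2 / (2 * q)) / p"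
      using wt 4 half by (simp add: ramp_inv_def)
    have "p * (- R) \<le> p * \<theta>" using \<theta> p_pos by (intro mult_left_mono) auto
    then have "p\<^sup>2 / (2 * q) \<le> w t + 1 + p * \<theta>" using pR wt 4 half by simp
    moreover have pz: "p * (?z + \<theta>) = w t + 1 + p\<^sup>2 / (2 * q) + p * \<theta>"
      unfolding distrib_left z using p_pos by simp
    ultimately have "p * (p / q) \<le> p * (?z + \<theta>)" by (simp add: power2_eq_square)
    then have "p / q \<le> ?z + \<theta>" using mult_le_cancel_left_pos[OF p_pos] by blast
    then have "prof 3 p q (w t) \<theta> = w t + p * \<theta>"
      using pz by (simp add: prof_def ramp_linear)
    then show ?thesis using w_ge_line[OF d1_le d2_le q_pos tb(3) \<theta>] 4 by simp
  qed
qed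

lemma not_touching:
  assumes p_le: "p \<le> L * (1 + L * R)"
    and init: "\<And>s. s \<in> {b - R..b} \<Longrightarrow> \<bar>u s\<bar> < exp (- (L * real k * R))" and bt: "b \<le> t"
  shows "u t \<noteq> 1"
proof
  assume ut: "u t = 1"
  have growth: "\<bar>u s\<bar> < exp (L * (s - b - real k * R))" if "s \<in> {b..t}" for s
    using growth_bound[OF init that] by (simp add: algebra_simps flip: exp_add)
  from growth[of t] bt have "1 < exp (L * (t - b - real k * R))" by (simp add: ut)
  then have t: "b + real k * R < t" using L_pos by (simp add: zero_less_mult_iff)
  have "1 * R \<le> real k * R" using k R_pos by (intro mult_right_mono) auto
  then have tR: "b + R < t" using t by simp
  have "du t < - \<epsilon>"
    using t tR ut eps growth
    by (intro steep_descent touching_history[OF p_le]) (auto intro: less_imp_le)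
  then have "du t < 0" using eps by simp
  moreover have "(u has_real_derivative du t) (at t within {b..t})" using bt by (intro du) auto
  ultimately obtain d where d: "0 < d" "\<And>h. 0 < h \<Longrightarrow> t - h \<in> {b..t} \<Longrightarrow> h < d \<Longrightarrow> u t < u (t - h)"
    using has_real_derivative_neg_dec_left by blast
  define h where "h = min (d / 2) (t - b)"
  have h: "0 < h" "t - h \<in> {b..t}" "h < d" using d(1) tR R_pos by (auto simp: h_def min_def)
  from d(2)[OF this] bound[of "t - h"] h R_pos ut show False by auto
qed

end

end

section \<open>Stability in the small\<close>

definition dde_rhs :: "real \<Rightarrow> real \<Rightarrow> real \<Rightarrow> real \<Rightarrow> (real \<Rightarrow> real) \<Rightarrow> real \<Rightarrow> real" where
  "dde_rhs \<mu> \<sigma> a c u s = \<mu> * u s + \<sigma> * u (s - a - c * u s)"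

locale stable_dde =
  fixes \<mu> \<sigma> a c \<delta> \<epsilon> p q :: real and k :: nat
  assumes sigma: "\<sigma> < 0" and a_pos: "0 < a" and k: "k \<in> {1, 2, 3}" and delta: "0 < \<delta>"
    and c_delta: "\<bar>c\<bar> * \<delta> < a"
    and slopes: "D1 \<mu> \<sigma> \<delta> \<bar>c\<bar> \<le> p" "D2 \<mu> \<sigma> \<delta> \<bar>c\<bar> \<le> q" "0 < q" "p\<^sup>2 \<le> q"
      "p \<le> (\<bar>\<mu>\<bar> + \<bar>\<sigma>\<bar>) * (1 + (\<bar>\<mu>\<bar> + \<bar>\<sigma>\<bar>) * (a + \<bar>c\<bar> * \<delta>))"
    and eps: "0 < \<epsilon>" "\<epsilon> < 1"
    and margin: "\<And>v x r. - 1 \<le> v \<Longrightarrow> 0 \<le> r \<Longrightarrow> r \<le> a + \<bar>c\<bar> * \<delta> \<Longrightarrow> x \<le> 1 \<Longrightarrow> 1 - \<epsilon> \<le> x \<Longrightarrow>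
      - \<epsilon> \<le> \<mu> * x + \<sigma> * v \<Longrightarrow> Jf \<mu> \<sigma> (prof k p q v) v r < 1 - \<epsilon>"
begin

definition R :: real where "R = a + \<bar>c\<bar> * \<delta>"

abbreviation rhs :: "(real \<Rightarrow> real) \<Rightarrow> real \<Rightarrow> real" where
  "rhs \<equiv> dde_rhs \<mu> \<sigma> a c"

lemma R_pos: "0 < R"
  using a_pos delta by (auto simp: R_def intro: add_pos_nonneg)

lemma normalised:
  assumes M: "M \<noteq> 0" "\<bar>M\<bar> \<le> \<delta>"
    and bound: "\<And>s. s \<in> {b - R..t} \<Longrightarrow> \<bar>u s\<bar> \<le> \<bar>M\<bar>"
    and dde: "\<And>s. s \<in> {b..t} \<Longrightarrow> (u has_real_derivative rhs u s) (at s within {b..t})"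
  defines "U \<equiv> \<lambda>s. u s / M"
  shows "bounded_dde \<mu> \<sigma> a (c * M) b t R U"
    and "bounded_dde.d1 \<mu> \<sigma> (c * M) \<le> p" and "bounded_dde.d2 \<mu> \<sigma> (c * M) \<le> q"
    and "bounded_dde.du \<mu> \<sigma> a (c * M) U s = rhs u s / M"
proof -
  have cM: "\<bar>c * M\<bar> \<le> \<bar>c\<bar> * \<delta>" using M by (simp add: abs_mult mult_left_mono)
  show bd: "bounded_dde \<mu> \<sigma> a (c * M) b t R U"
  proof
    show "\<bar>c * M\<bar> < a" "a + \<bar>c * M\<bar> \<le> R" using cM c_delta by (simp_all add: R_def)
    show "\<bar>U s\<bar> \<le> 1" if "s \<in> {b - R..t}" for s
      using bound[OF that] M by (simp add: U_def)
    show "(U has_real_derivative \<mu> * U s + \<sigma> * U (s - a - c * M * U s)) (at s within {b..t})"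
      if "s \<in> {b..t}" for s
      using DERIV_cdivide[OF dde[OF that], of M] M
      by (simp add: U_def dde_rhs_def add_divide_distrib)
  qed (fact sigma)
  interpret bounded_dde \<mu> \<sigma> a "c * M" b t R U by fact
  have L: "0 \<le> \<bar>\<mu>\<bar> + \<bar>\<sigma>\<bar>" by simp
  have Q: "(\<bar>\<mu>\<bar> + \<bar>\<sigma>\<bar>) * \<bar>c * M\<bar> \<le> (\<bar>\<mu>\<bar> + \<bar>\<sigma>\<bar>) * \<bar>c\<bar> * \<delta>"
    using mult_left_mono[OF cM L] by simp
  then have 1: "d1 \<le> D1 \<mu> \<sigma> \<delta> \<bar>c\<bar>"
    unfolding d1_def Q_def L_def D1_def by (intro mult_left_mono) auto
  then show "d1 \<le> p" using slopes by simp
  have 2: "d1\<^sup>2 \<le> (D1 \<mu> \<sigma> \<delta> \<bar>c\<bar>)\<^sup>2" using 1 d1_pos by (intro power_mono) auto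
  have "L\<^sup>2 * Q \<le> L\<^sup>2 * (L * \<bar>c\<bar> * \<delta>)"
    unfolding Q_def using Q by (intro mult_left_mono) (auto simp: L_def)
  then have 3: "L\<^sup>2 * Q \<le> (\<bar>\<mu>\<bar> + \<bar>\<sigma>\<bar>) ^ 3 * \<bar>c\<bar> * \<delta>"
    by (simp add: L_def power3_eq_cube power2_eq_square mult_ac)
  have "\<bar>\<sigma>\<bar> * \<bar>c * M\<bar> \<le> \<bar>\<sigma>\<bar> * (\<bar>c\<bar> * \<delta>)" using cM by (intro mult_left_mono) auto
  then have 4: "1 + \<bar>\<sigma>\<bar> * \<bar>c * M\<bar> \<le> 1 + \<bar>\<sigma> * \<bar>c\<bar>\<bar> * \<delta>" by (simp add: abs_mult mult_ac)
  have "d2 \<le> D2 \<mu> \<sigma> \<delta> \<bar>c\<bar>"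
    unfolding d2_def D2_def
  proof (rule mult_mono[OF _ 4])
    show "d1\<^sup>2 + L\<^sup>2 * Q \<le> (D1 \<mu> \<sigma> \<delta> \<bar>c\<bar>)\<^sup>2 + (\<bar>\<mu>\<bar> + \<bar>\<sigma>\<bar>) ^ 3 * \<bar>\<bar>c\<bar>\<bar> * \<delta>" using 2 3 by simp
  qed (use delta in auto)
  then show "d2 \<le> q" using slopes by simp
  show "du s = rhs u s / M"
    unfolding du_def w_def lag_def using M by (simp add: U_def dde_rhs_def add_divide_distrib)
qed

lemma margin': "- 1 \<le> v \<Longrightarrow> 0 \<le> r \<Longrightarrow> r \<le> R \<Longrightarrow> x \<le> 1 \<Longrightarrow> 1 - \<epsilon> \<le> x \<Longrightarrow>
    - \<epsilon> \<le> \<mu> * x + \<sigma> * v \<Longrightarrow> Jf \<mu> \<sigma> (prof k p q v) v r < 1 - \<epsilon>"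
  using margin by (simp add: R_def)

definition \<delta>2 :: real where
  "\<delta>2 = \<delta> * exp (- real k * (\<bar>\<mu>\<bar> + \<bar>\<sigma>\<bar>) * R)"

lemma \<delta>2_less: "\<delta>2 < \<delta>"
proof -
  have "1 \<le> k" using k by auto
  then have "0 < real k * (\<bar>\<mu>\<bar> + \<bar>\<sigma>\<bar>) * R" using sigma R_pos by (intro mult_pos_pos) auto
  then show ?thesis using delta by (simp add: \<delta>2_def)
qed

lemma abs_not_touching:
  assumes init: "\<And>s. s \<in> {- R..0} \<Longrightarrow> \<bar>u s\<bar> < \<delta>2"
    and t: "0 \<le> t" and bound: "\<And>s. s \<in> {0..t} \<Longrightarrow> \<bar>u s\<bar> \<le> \<delta>"
    and dde: "\<And>s. s \<in> {0..t} \<Longrightarrow> (u has_real_derivative rhs u s) (at s within {0..t})"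
  shows "\<bar>u t\<bar> < \<delta>"
proof -
  have "u t / M \<noteq> 1" if M: "M = \<delta> \<or> M = - \<delta>" for M
  proof -
    have M': "M \<noteq> 0" "\<bar>M\<bar> = \<delta>" using M delta by auto
    have bound': "\<bar>u s\<bar> \<le> \<bar>M\<bar>" if "s \<in> {0 - R..t}" for s
      using init[of s] bound[of s] \<delta>2_less that M' by (cases "0 \<le> s") auto
    note norm = normalised[OF M'(1) _ bound' dde]
    interpret bounded_dde \<mu> \<sigma> a "c * M" 0 t R "\<lambda>s. u s / M" using norm(1) M' by simp
    show ?thesis
    proof (rule not_touching[OF norm(2,3) _ _ _ _ margin'])
      show "p \<le> L * (1 + L * R)" using slopes(5) by (simp add: L_def R_def)
      fix s assume "s \<in> {0 - R..0}"
      then have "\<bar>u s\<bar> < \<delta> * exp (- (L * real k * R))"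
        using init[of s] by (simp add: \<delta>2_def L_def mult_ac)
      then show "\<bar>u s / M\<bar> < exp (- (L * real k * R))"
        using M' delta by (simp add: pos_divide_less_eq mult.commute)
    qed (use M' slopes k eps t in auto)
  qed
  from this[of \<delta>] this[of "- \<delta>"] have "u t \<noteq> \<delta>" "u t \<noteq> - \<delta>" using delta by auto
  then show ?thesis using bound[of t] t by auto
qed

lemma stays_bounded:
  assumes init: "\<And>s. s \<in> {- R..0} \<Longrightarrow> \<bar>u s\<bar> < \<delta>2"
    and cont: "continuous_on {0..t} u"
    and dde: "\<And>x s. x \<in> {0..t} \<Longrightarrow> (\<And>y. y \<in> {0..x} \<Longrightarrow> \<bar>u y\<bar> \<le> \<delta>) \<Longrightarrow> s \<in> {0..x} \<Longrightarrow>
      (u has_real_derivative rhs u s) (at s within {0..x})"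
    and s: "s \<in> {0..t}"
  shows "\<bar>u s\<bar> < \<delta>"
proof (rule continuous_bootstrap[OF _ continuous_on_const _ _ s])
  show "continuous_on {0..t} (\<lambda>s. \<bar>u s\<bar>)" using cont by (intro continuous_intros)
  show "\<bar>u 0\<bar> < \<delta>" using init[of 0] \<delta>2_less R_pos by simp
  show "\<bar>u x\<bar> < \<delta>" if "x \<in> {0..t}" "\<And>y. y \<in> {0..x} \<Longrightarrow> \<bar>u y\<bar> \<le> \<delta>" for x
    using that by (intro abs_not_touching init dde) auto
qed

lemma eventually_below:
  assumes U: "\<And>s. 0 \<le> s \<Longrightarrow> (U has_real_derivative dU s) (at s within {0..})"
    and low: "\<And>s. 0 \<le> s \<Longrightarrow> - 1 \<le> U s"
    and T: "0 \<le> T" and descent: "\<And>s. T \<le> s \<Longrightarrow> 1 - \<epsilon> \<le> U s \<Longrightarrow> dU s < - \<epsilon>"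
  shows "\<exists>T'\<ge>0. \<forall>s\<ge>T'. U s < 1 - \<epsilon>"
proof -
  have U': "(U has_real_derivative dU s) (at s within {x..y})" if "0 \<le> x" "s \<in> {x..y}" for s x y
    using that by (intro has_field_derivative_subset[OF U]) auto
  have "\<exists>T'\<ge>T. U T' < 1 - \<epsilon>"
  proof (rule ccontr)
    assume "\<not> ?thesis"
    then have high: "1 - \<epsilon> \<le> U s" if "T \<le> s" for s using that by force
    define n where "n = (U T + 2) / \<epsilon>"
    have n: "0 \<le> n" using low[OF T] eps by (simp add: n_def)
    have "U (T + n) + \<epsilon> * (T + n) \<le> U T + \<epsilon> * T"
    proof -
      have "- (U T + \<epsilon> * T) \<le> - (U (T + n) + \<epsilon> * (T + n))"
      proof (rule within_deriv_nonneg_imp_le[where f = "\<lambda>s. - (U s + \<epsilon> * s)" and f' = "\<lambda>s. - (dU s + \<epsilon>)"])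
        fix s assume s: "s \<in> {T..T + n}"
        show "((\<lambda>s. - (U s + \<epsilon> * s)) has_real_derivative - (dU s + \<epsilon>)) (at s within {T..T + n})"
          using U'[OF T s] by (auto intro!: derivative_eq_intros)
        show "0 \<le> - (dU s + \<epsilon>)" using descent[of s] high[of s] s by simp
      qed (use n in simp)
      then show ?thesis by simp
    qed
    then have "U (T + n) \<le> U T - \<epsilon> * n" by (simp add: distrib_left)
    also have "\<epsilon> * n = U T + 2" using eps by (simp add: n_def)
    finally show False using low[of "T + n"] T n by simp
  qed
  then obtain T' where T': "T \<le> T'" "U T' < 1 - \<epsilon>" by blast
  have "U s < 1 - \<epsilon>" if s: "T' \<le> s" for s
  proof (rule continuous_bootstrap[where f = U and g = "\<lambda>_. 1 - \<epsilon>" and b = T' and t = s])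
    show "continuous_on {T'..s} U" using T T' by (intro DERIV_continuous_on[where D = dU] U') auto
    fix x assume x: "x \<in> {T'..s}" and le: "\<And>y. y \<in> {T'..x} \<Longrightarrow> U y \<le> 1 - \<epsilon>"
    show "U x < 1 - \<epsilon>"
    proof (rule ccontr)
      assume "\<not> U x < 1 - \<epsilon>"
      then have eq: "U x = 1 - \<epsilon>" using le[of x] x by simp
      then have "dU x < 0" using descent[of x] x T' eps by simp
      moreover have "(U has_real_derivative dU x) (at x within {T'..x})"
        using x T T' by (intro U') auto
      ultimately obtain d where d: "0 < d"
        "\<And>h. 0 < h \<Longrightarrow> x - h \<in> {T'..x} \<Longrightarrow> h < d \<Longrightarrow> U x < U (x - h)"
        using has_real_derivative_neg_dec_left by blast
      define h where "h = min (d / 2) (x - T')"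
      have "T' < x" using eq T' x by (cases "x = T'") auto
      then have h: "0 < h" "x - h \<in> {T'..x}" "h < d" using d(1) by (auto simp: h_def min_def)
      from d(2)[OF this] le[OF h(2)] eq show False by simp
    qed
  qed (use T' s in auto)
  then show ?thesis using T T' by (intro exI[of _ T']) auto
qed

lemma bound_contracts:
  assumes dde: "\<And>s. 0 \<le> s \<Longrightarrow> (u has_real_derivative rhs u s) (at s within {0..})"
    and M: "0 < M" "M \<le> \<delta>" and all: "\<And>s. 0 \<le> s \<Longrightarrow> \<bar>u s\<bar> \<le> \<delta>"
    and T: "0 \<le> T" "\<And>s. T \<le> s \<Longrightarrow> \<bar>u s\<bar> \<le> M"
  shows "\<exists>T'\<ge>0. \<forall>s\<ge>T'. \<bar>u s\<bar> \<le> (1 - \<epsilon>) * M"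
proof -
  have "\<exists>T'\<ge>0. \<forall>s\<ge>T'. u s / N < 1 - \<epsilon>" if N: "N = M \<or> N = - M" for N
  proof -
    have N': "N \<noteq> 0" "\<bar>N\<bar> = M" using N M by auto
    define T1 where "T1 = (T + R) + 3 * R + p / q"
    have "0 < p" using slopes(1) ramp_slopes_D[OF sigma, of \<delta> \<mu> "\<bar>c\<bar>"] delta
      by (simp add: ramp_slopes_def)
    then have T1: "T + R \<le> T1" using R_pos slopes(3) by (simp add: T1_def)
    have descent: "rhs u (T + s) / N < - \<epsilon>" if s: "T1 - T \<le> s" "1 - \<epsilon> \<le> u (T + s) / N" for s
    proof -
      let ?t = "T + s"
      have t: "T1 \<le> ?t" using s by simp
      have bound': "\<bar>u x\<bar> \<le> \<bar>N\<bar>" if "x \<in> {(T + R) - R..?t}" for x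
        using T(2)[of x] that N' by simp
      have dde': "(u has_real_derivative rhs u x) (at x within {T + R..?t})"
        if "x \<in> {T + R..?t}" for x
        using that T R_pos by (intro has_field_derivative_subset[OF dde]) auto
      note norm = normalised[OF N'(1) _ bound' dde']
      interpret bounded_dde \<mu> \<sigma> a "c * N" "T + R" ?t R "\<lambda>s. u s / N" using norm(1) M N' by simp
      have "du ?t < - \<epsilon>"
        using t s N' M slopes k eps norm(2,3)
        by (intro late_steep_descent[of p q k] margin') (auto simp: T1_def)
      then show ?thesis using norm(4) N' M by simp
    qed
    have "\<exists>T'\<ge>0. \<forall>s\<ge>T'. u (T + s) / N < 1 - \<epsilon>"
    proof (rule eventually_below[where U = "\<lambda>s. u (T + s) / N" and dU = "\<lambda>s. rhs u (T + s) / N"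
          and T = "T1 - T"])
      fix s :: real assume s: "0 \<le> s"
      have "(u has_real_derivative rhs u (T + s)) (at (T + s) within (+) T ` {0..})"
        using s T by (intro has_field_derivative_subset[OF dde]) auto
      then have "((\<lambda>s. u (T + s)) has_real_derivative rhs u (T + s)) (at s within {0..})"
        using DERIV_image_chain[of u "rhs u (T + s)" "\<lambda>s. T + s" s "{0..}" 1]
          DERIV_add[OF DERIV_const DERIV_ident, of T s "{0..}"] by (simp add: o_def)
      then show "((\<lambda>s. u (T + s) / N) has_real_derivative rhs u (T + s) / N) (at s within {0..})"
        by (rule DERIV_cdivide)
      have "\<bar>u (T + s) / N\<bar> \<le> 1" using T(2)[of "T + s"] s N' M by simp
      then show "- 1 \<le> u (T + s) / N" by linarith
    next
      show "0 \<le> T1 - T" using T1 R_pos by simp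
    qed (use descent in auto)
    then obtain T' where T': "T' \<ge> 0" "\<And>s. s \<ge> T' \<Longrightarrow> u (T + s) / N < 1 - \<epsilon>" by blast
    have "u s / N < 1 - \<epsilon>" if "T + T' \<le> s" for s using T'(2)[of "s - T"] that by simp
    then show ?thesis using T T'(1) by (intro exI[of _ "T + T'"]) auto
  qed
  from this[of M] this[of "- M"] obtain T1 T2 where
    "T1 \<ge> 0" "\<And>s. s \<ge> T1 \<Longrightarrow> u s / M < 1 - \<epsilon>" "\<And>s. s \<ge> T2 \<Longrightarrow> u s / (- M) < 1 - \<epsilon>" by blast
  moreover have "\<bar>u s\<bar> \<le> (1 - \<epsilon>) * M" if "u s / M < 1 - \<epsilon>" "u s / (- M) < 1 - \<epsilon>" for s
    using that M by (auto simp: abs_le_iff field_simps)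
  ultimately show ?thesis by (intro exI[of _ "max T1 T2"]) auto
qed

lemma tends_to_zero:
  assumes dde: "\<And>s. 0 \<le> s \<Longrightarrow> (u has_real_derivative rhs u s) (at s within {0..})"
    and bound: "\<And>s. 0 \<le> s \<Longrightarrow> \<bar>u s\<bar> \<le> \<delta>"
  shows "(u \<longlongrightarrow> 0) at_top"
proof -
  have iter: "\<exists>T\<ge>0. \<forall>s\<ge>T. \<bar>u s\<bar> \<le> (1 - \<epsilon>) ^ n * \<delta>" for n
  proof (induction n)
    case 0
    then show ?case using bound by auto
  next
    case (Suc n)
    then obtain T where T: "T \<ge> 0" "\<And>s. T \<le> s \<Longrightarrow> \<bar>u s\<bar> \<le> (1 - \<epsilon>) ^ n * \<delta>" by blast
    have "(1 - \<epsilon>) ^ n * \<delta> \<le> 1 * \<delta>"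
      using eps delta by (intro mult_right_mono power_le_one) auto
    then have "\<exists>T'\<ge>0. \<forall>s\<ge>T'. \<bar>u s\<bar> \<le> (1 - \<epsilon>) * ((1 - \<epsilon>) ^ n * \<delta>)"
      using T eps delta by (intro bound_contracts[OF dde _ _ bound T]) auto
    then show ?case by (simp add: mult.assoc)
  qed
  show ?thesis
  proof (rule tendstoI)
    fix e :: real assume e: "0 < e"
    then obtain n where n: "(1 - \<epsilon>) ^ n < e / \<delta>"
      using real_arch_pow_inv[of "e / \<delta>" "1 - \<epsilon>"] eps delta by auto
    obtain T where T: "\<And>s. s \<ge> T \<Longrightarrow> \<bar>u s\<bar> \<le> (1 - \<epsilon>) ^ n * \<delta>" using iter by blast
    have "(1 - \<epsilon>) ^ n * \<delta> < e" using n delta by (simp add: field_simps)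
    then have "dist (u s) 0 < e" if "s \<ge> T" for s using T[OF that] by simp
    then show "\<forall>\<^sub>F s in at_top. dist (u s) 0 < e"
      unfolding eventually_at_top_linorder by blast
  qed
qed

end

section \<open>Existence of solutions\<close>

lemma continuous_on_indefinite_integral_clamped:
  fixes F :: "real \<Rightarrow> real"
  assumes "r \<le> s" "continuous_on UNIV F"
  shows "continuous_on UNIV (\<lambda>t. integral {r..max r (min s t)} F)"
proof -
  have "F integrable_on {r..s}"
    using assms by (intro integrable_continuous_real continuous_on_subset[OF assms(2)]) auto
  then have "continuous_on {r..s} (\<lambda>t. integral {r..t} F)" by (rule indefinite_integral_continuous_1)
  then show ?thesis
    by (rule continuous_on_compose2) (use assms in \<open>auto intro!: continuous_intros\<close>)
qed

locale peano =
  fixes f :: "real \<Rightarrow> real \<Rightarrow> real" and r s B u0 :: real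
  assumes rs: "r < s" and cont: "continuous_on UNIV (\<lambda>p. f (fst p) (snd p))"
    and bound: "\<And>t x. t \<in> {r..s} \<Longrightarrow> \<bar>f t x\<bar> \<le> B"
begin

lemma continuous_on_f:
  "continuous_on A g \<Longrightarrow> continuous_on A h \<Longrightarrow> continuous_on A (\<lambda>t. f (g t) (h t))"
  using continuous_on_compose2[OF cont, of A "\<lambda>t. (g t, h t)"] by (auto intro: continuous_intros)

definition cl :: "real \<Rightarrow> real" where "cl t = max r (min s t)"

lemma cl: "cl t \<in> {r..s}"
  using rs by (auto simp: cl_def)

lemma cl_lipschitz: "\<bar>cl x - cl y\<bar> \<le> \<bar>x - y\<bar>"
  by (auto simp: cl_def max_def min_def)

text \<open>Tonelli's delayed approximations: the delay \<open>e\<close> makes the equation explicit.\<close>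

lemma delayed_solution:
  assumes e: "0 < e"
  shows "\<exists>v. continuous_on UNIV v \<and> (\<forall>t. v t = u0 + integral {r..cl t} (\<lambda>x. f x (v (x - e))))"
proof -
  have "\<exists>v. continuous_on UNIV v \<and> (\<forall>t. cl t \<le> r + real n * e \<longrightarrow>
      v t = u0 + integral {r..cl t} (\<lambda>x. f x (v (x - e))))" for n
  proof (induction n)
    case 0
    have "v0 = v0 + integral {r..cl t} g" if "cl t \<le> r" for v0 t and g :: "real \<Rightarrow> real"
      using that cl[of t] by simp
    then show ?case by (intro exI[of _ "\<lambda>_. u0"]) auto
  next
    case (Suc n)
    then obtain v where v: "continuous_on UNIV v"
      "\<And>t. cl t \<le> r + real n * e \<Longrightarrow> v t = u0 + integral {r..cl t} (\<lambda>x. f x (v (x - e)))" by blast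
    define v' where "v' t = u0 + integral {r..cl t} (\<lambda>x. f x (v (x - e)))" for t
    have "continuous_on UNIV (\<lambda>x. v (x - e))"
      by (rule continuous_on_compose2[OF v(1)]) (auto intro!: continuous_intros)
    then have "continuous_on UNIV (\<lambda>x. f x (v (x - e)))" by (intro continuous_on_f continuous_on_id)
    then have "continuous_on UNIV v'"
      unfolding v'_def[abs_def] cl_def
      using rs by (intro continuous_intros continuous_on_indefinite_integral_clamped) auto
    moreover have "v' t = u0 + integral {r..cl t} (\<lambda>x. f x (v' (x - e)))"
      if t: "cl t \<le> r + real (Suc n) * e" for t
    proof -
      have "v' (x - e) = v (x - e)" if "x \<in> {r..cl t}" for x
      proof -
        have "x - e \<le> r + real n * e" using that t by (simp add: algebra_simps)
        then have "cl (x - e) \<le> r + real n * e" using e by (simp add: cl_def)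
        then show ?thesis using v(2) by (simp add: v'_def)
      qed
      then have "integral {r..cl t} (\<lambda>x. f x (v (x - e))) = integral {r..cl t} (\<lambda>x. f x (v' (x - e)))"
        by (intro Henstock_Kurzweil_Integration.integral_cong) simp
      then show ?thesis by (simp add: v'_def)
    qed
    ultimately show ?case by blast
  qed
  moreover obtain n :: nat where n: "(s - r) / e \<le> real n" using real_arch_simple by blast
  then have "cl t \<le> r + real n * e" for t
    using cl[of t] e by (simp add: field_simps)
  ultimately show ?thesis by meson
qed

lemma delayed_lipschitz:
  assumes v: "continuous_on UNIV v" "\<And>t. v t = u0 + integral {r..cl t} (\<lambda>x. f x (v (x - e)))"
  shows "\<bar>v x - v y\<bar> \<le> B * \<bar>x - y\<bar>"
proof -
  have B: "0 \<le> B" using bound[of r 0] rs by auto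
  let ?F = "\<lambda>x. f x (v (x - e))"
  have "continuous_on UNIV (\<lambda>x. v (x - e))"
    by (rule continuous_on_compose2[OF v(1)]) (auto intro!: continuous_intros)
  then have F: "continuous_on A ?F" for A
    by (rule continuous_on_subset[OF continuous_on_f[OF continuous_on_id]]) simp
  have le: "\<bar>v y - v x\<bar> \<le> B * (cl y - cl x)" if "cl x \<le> cl y" for x y
  proof -
    have "integral {r..cl x} ?F + integral {cl x..cl y} ?F = integral {r..cl y} ?F"
      using that cl by (intro Henstock_Kurzweil_Integration.integral_combine)
        (auto intro: integrable_continuous_real F)
    then have "v y - v x = integral {cl x..cl y} ?F"
      unfolding v(2)[of x] v(2)[of y] by linarith
    moreover have "norm (integral {cl x..cl y} ?F) \<le> B * (cl y - cl x)"
      using that bound cl[of x] cl[of y] by (intro integral_bound F) auto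
    ultimately show ?thesis by simp
  qed
  have "\<bar>v x - v y\<bar> \<le> B * \<bar>cl x - cl y\<bar>"
    using le[of x y] le[of y x] by (cases "cl x \<le> cl y") (auto simp: abs_minus_commute)
  also have "\<dots> \<le> B * \<bar>x - y\<bar>" using B cl_lipschitz by (intro mult_left_mono)
  finally show ?thesis .
qed

theorem solution_exists:
  "\<exists>u. continuous_on {r..s} u \<and> (\<forall>t\<in>{r..s}. u t = u0 + integral {r..t} (\<lambda>x. f x (u x)))"
proof -
  define e where "e n = 1 / real (Suc n)" for n
  have "\<exists>v. continuous_on UNIV v \<and> (\<forall>t. v t = u0 + integral {r..cl t} (\<lambda>x. f x (v (x - e n))))" for n
    by (rule delayed_solution) (simp add: e_def)
  then obtain V where V: "\<And>n. continuous_on UNIV (V n)"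
    "\<And>n t. V n t = u0 + integral {r..cl t} (\<lambda>x. f x (V n (x - e n)))" by metis
  note lip = delayed_lipschitz[OF V]
  have B: "0 \<le> B" using bound[of r 0] rs by auto
  have Vr: "V n r = u0" for n using V(2)[of n r] rs by (simp add: cl_def)
  obtain g k where g: "continuous_on {r..s} g" and k: "strict_mono (k :: nat \<Rightarrow> nat)"
    and conv: "\<And>d. 0 < d \<Longrightarrow> \<exists>N. \<forall>n x. n \<ge> N \<and> x \<in> {r..s} \<longrightarrow> norm (V (k n) x - g x) < d"
  proof (rule Arzela_Ascoli[of "{r..s}" V "\<bar>u0\<bar> + B * (s - r)"])
    show "norm (V n x) \<le> \<bar>u0\<bar> + B * (s - r)" if x: "x \<in> {r..s}" for n x
    proof -
      have "\<bar>V n x - u0\<bar> \<le> B * \<bar>x - r\<bar>" using lip[of n x r] by (simp add: Vr)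
      also have "\<dots> \<le> B * (s - r)" using x B by (intro mult_left_mono) auto
      finally show ?thesis by simp
    qed
    show "\<exists>d. 0 < d \<and> (\<forall>n y. y \<in> {r..s} \<and> norm (x - y) < d \<longrightarrow> norm (V n x - V n y) < d')"
      if "x \<in> {r..s}" "0 < d'" for x d'
    proof (intro exI[of _ "d' / (B + 1)"] conjI allI impI)
      show "0 < d' / (B + 1)" using that B by simp
      fix n y assume y: "y \<in> {r..s} \<and> norm (x - y) < d' / (B + 1)"
      have "norm (V n x - V n y) \<le> B * \<bar>x - y\<bar>" using lip[of n x y] by simp
      also have "\<dots> \<le> (B + 1) * \<bar>x - y\<bar>" by (intro mult_right_mono) auto
      also have "\<dots> < d'" using y B by (simp add: pos_less_divide_eq mult.commute)
      finally show "norm (V n x - V n y) < d'" .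
    qed
  qed (auto intro: that)
  have Vg: "(\<lambda>n. V (k n) x) \<longlonglongrightarrow> g x" if "x \<in> {r..s}" for x
    unfolding LIMSEQ_def dist_norm using conv that by meson
  have e0: "(\<lambda>n. B * e (k n)) \<longlonglongrightarrow> 0"
  proof -
    have "e \<longlonglongrightarrow> 0" using LIMSEQ_Suc[OF lim_1_over_n] by (simp add: e_def[abs_def])
    then have "(\<lambda>n. e (k n)) \<longlonglongrightarrow> 0" using LIMSEQ_subseq_LIMSEQ[OF _ k] by (fastforce simp: o_def)
    then show ?thesis using tendsto_mult_left[of _ 0 sequentially B] by simp
  qed
  have Vg': "(\<lambda>n. V (k n) (x - e (k n))) \<longlonglongrightarrow> g x" if "x \<in> {r..s}" for x
  proof -
    have "(\<lambda>n. V (k n) (x - e (k n)) - V (k n) x) \<longlonglongrightarrow> 0"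
    proof (rule Lim_null_comparison[OF _ e0])
      have "0 \<le> e n" for n by (simp add: e_def)
      then show "\<forall>\<^sub>F n in sequentially. norm (V (k n) (x - e (k n)) - V (k n) x) \<le> B * e (k n)"
        using lip[of "k _" "x - e (k _)" x] by (intro always_eventually) auto
    qed
    from tendsto_add[OF this Vg[OF that]] show ?thesis by simp
  qed
  have "g t = u0 + integral {r..t} (\<lambda>x. f x (g x))" if t: "t \<in> {r..s}" for t
  proof -
    have "(\<lambda>n. integral {r..t} (\<lambda>x. f x (V (k n) (x - e (k n))))) \<longlonglongrightarrow> integral {r..t} (\<lambda>x. f x (g x))"
    proof (rule dominated_convergence)
      show "(\<lambda>x. f x (V (k n) (x - e (k n)))) integrable_on {r..t}" for n
      proof (intro integrable_continuous_real continuous_on_f continuous_on_id)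
        show "continuous_on {r..t} (\<lambda>x. V (k n) (x - e (k n)))"
          by (rule continuous_on_compose2[OF V(1)]) (auto intro!: continuous_intros)
      qed
      show "(\<lambda>x. B) integrable_on {r..t}" by (rule integrable_const_ivl)
      show "norm (f x (V (k n) (x - e (k n)))) \<le> B" if "x \<in> {r..t}" for n x
        using that t bound by simp
      show "(\<lambda>n. f x (V (k n) (x - e (k n)))) \<longlonglongrightarrow> f x (g x)" if "x \<in> {r..t}" for x
      proof -
        have "continuous_on UNIV (f x)"
          using continuous_on_f[OF continuous_on_const continuous_on_id, of UNIV x] by simp
        then have "isCont (f x) (g x)" by (simp add: continuous_on_eq_continuous_at)
        then show ?thesis using that t by (intro isCont_tendsto_compose[OF _ Vg']) auto
      qed
    qed
    then have "(\<lambda>n. u0 + integral {r..t} (\<lambda>x. f x (V (k n) (x - e (k n))))) \<longlonglongrightarrow>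
        u0 + integral {r..t} (\<lambda>x. f x (g x))" by (intro tendsto_intros)
    moreover have "cl t = t" using t by (simp add: cl_def)
    ultimately have "(\<lambda>n. V (k n) t) \<longlonglongrightarrow> u0 + integral {r..t} (\<lambda>x. f x (g x))"
      using V(2)[of "k _" t] by simp
    with Vg[OF t] show ?thesis by (rule LIMSEQ_unique)
  qed
  with g show ?thesis by blast
qed

end

definition clamp :: "real \<Rightarrow> real \<Rightarrow> real" where
  "clamp d x = max (- d) (min d x)"

text \<open>Truncating the values of \<open>u\<close> at \<open>\<plusminus>d\<close> keeps the delay at least \<open>a - \<bar>c\<bar> * d\<close>, so that the
  method of steps applies; no generality is lost for solutions bounded by \<open>d\<close>.\<close>

definition truncated_rhs ::
    "real \<Rightarrow> real \<Rightarrow> real \<Rightarrow> real \<Rightarrow> real \<Rightarrow> (real \<Rightarrow> real) \<Rightarrow> real \<Rightarrow> real" where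
  "truncated_rhs \<mu> \<sigma> a c d u s = \<mu> * clamp d (u s) + \<sigma> * u (s - a - c * clamp d (u s))"

lemma truncated_rhs_eq: "\<bar>u s\<bar> \<le> d \<Longrightarrow> truncated_rhs \<mu> \<sigma> a c d u s = dde_rhs \<mu> \<sigma> a c u s"
  by (auto simp: truncated_rhs_def dde_rhs_def clamp_def)

locale truncated_dde =
  fixes \<mu> \<sigma> a c d :: real
  assumes d: "0 < d" and c_d: "\<bar>c\<bar> * d < a"
begin

abbreviation G :: "(real \<Rightarrow> real) \<Rightarrow> real \<Rightarrow> real" where
  "G \<equiv> truncated_rhs \<mu> \<sigma> a c d"

definition h :: real where "h = a - \<bar>c\<bar> * d"

lemma h_pos: "0 < h"
  using c_d by (simp add: h_def)

lemma abs_clamp: "\<bar>clamp d x\<bar> \<le> d"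
  using d by (auto simp: clamp_def)

lemma abs_c_clamp: "\<bar>c * clamp d x\<bar> \<le> \<bar>c\<bar> * d"
  using abs_clamp by (simp add: abs_mult mult_left_mono)

lemma arg_bounds: "s - (a + \<bar>c\<bar> * d) \<le> s - a - c * clamp d x" "s - a - c * clamp d x \<le> s - h"
  using abs_c_clamp[of x] by (auto simp: h_def)

lemma continuous_on_clamp: "continuous_on A g \<Longrightarrow> continuous_on A (\<lambda>x. clamp d (g x))"
  unfolding clamp_def by (intro continuous_intros)

lemma continuous_on_G:
  assumes u: "continuous_on {..s} u"
  shows "continuous_on {..s} (G u)"
proof -
  have "continuous_on {..s} (\<lambda>x. u (x - a - c * clamp d (u x)))"
  proof (rule continuous_on_compose2[OF u])
    show "continuous_on {..s} (\<lambda>x. x - a - c * clamp d (u x))"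
      using u by (intro continuous_intros continuous_on_clamp)
    show "(\<lambda>x. x - a - c * clamp d (u x)) ` {..s} \<subseteq> {..s}"
    proof
      fix y assume "y \<in> (\<lambda>x. x - a - c * clamp d (u x)) ` {..s}"
      then obtain x where "x \<le> s" "y = x - a - c * clamp d (u x)" by auto
      then show "y \<in> {..s}" using arg_bounds(2)[of x "u x"] h_pos by auto
    qed
  qed
  then show ?thesis
    unfolding truncated_rhs_def[abs_def] using u by (intro continuous_intros continuous_on_clamp)
qed

lemma G_cong:
  assumes "\<And>x. x \<le> s \<Longrightarrow> u x = v x"
  shows "G u s = G v s"
  using assms[of s] assms[of "s - a - c * clamp d (u s)"] arg_bounds(2)[of s "u s"] h_pos
  by (simp add: truncated_rhs_def)

lemma one_step:
  assumes \<psi>: "continuous_on {..r} \<psi>"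
  shows "\<exists>v. continuous_on {..r + h} v \<and> (\<forall>t\<le>r. v t = \<psi> t) \<and>
    (\<forall>t\<in>{r..r + h}. v t = \<psi> r + integral {r..t} (G v))"
proof -
  define f where "f t x = \<mu> * clamp d x + \<sigma> * \<psi> (min r (t - a - c * clamp d x))" for t x
  have "compact (\<psi> ` {r - (a + \<bar>c\<bar> * d)..r})"
    by (intro compact_continuous_image continuous_on_subset[OF \<psi>]) auto
  then obtain K where K: "\<And>x. x \<in> {r - (a + \<bar>c\<bar> * d)..r} \<Longrightarrow> \<bar>\<psi> x\<bar> \<le> K"
    using compact_imp_bounded bounded_real by (metis imageI)
  interpret peano f r "r + h" "\<bar>\<mu>\<bar> * d + \<bar>\<sigma>\<bar> * K" "\<psi> r"
  proof
    show "r < r + h" using h_pos by simp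
    have "continuous_on UNIV (\<lambda>p. \<psi> (min r (fst p - a - c * clamp d (snd p))))"
      by (rule continuous_on_compose2[OF \<psi>]) (auto intro!: continuous_intros continuous_on_clamp)
    then show "continuous_on UNIV (\<lambda>p. f (fst p) (snd p))"
      unfolding f_def by (intro continuous_intros continuous_on_clamp)
    fix t x assume t: "t \<in> {r..r + h}"
    have "\<bar>\<psi> (min r (t - a - c * clamp d x))\<bar> \<le> K"
      using arg_bounds[of t x] t c_d d by (intro K) auto
    then have "\<bar>\<mu>\<bar> * \<bar>clamp d x\<bar> + \<bar>\<sigma>\<bar> * \<bar>\<psi> (min r (t - a - c * clamp d x))\<bar> \<le>
        \<bar>\<mu>\<bar> * d + \<bar>\<sigma>\<bar> * K"
      using abs_clamp by (intro add_mono mult_left_mono) auto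
    then show "\<bar>f t x\<bar> \<le> \<bar>\<mu>\<bar> * d + \<bar>\<sigma>\<bar> * K"
      using abs_triangle_ineq[of "\<mu> * clamp d x" "\<sigma> * \<psi> (min r (t - a - c * clamp d x))"]
      by (simp add: f_def abs_mult)
  qed
  obtain u where u: "continuous_on {r..r + h} u"
    "\<And>t. t \<in> {r..r + h} \<Longrightarrow> u t = \<psi> r + integral {r..t} (\<lambda>x. f x (u x))"
    using solution_exists by blast
  have ur: "u r = \<psi> r" using u(2)[of r] h_pos by simp
  define v where "v t = (if t \<le> r then \<psi> t else u t)" for t
  have vu: "v t = u t" if "t \<in> {r..r + h}" for t using that ur by (auto simp: v_def)
  have "{..r + h} = {..r} \<union> {r..r + h}" using h_pos by auto
  then have "continuous_on {..r + h} v"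
    unfolding v_def[abs_def] using \<psi> u(1) ur by (simp only:) (intro continuous_on_If, auto)
  moreover have "v t = \<psi> r + integral {r..t} (G v)" if t: "t \<in> {r..r + h}" for t
  proof -
    have "f x (u x) = G v x" if x: "x \<in> {r..t}" for x
    proof -
      have "x - a - c * clamp d (u x) \<le> r" using arg_bounds(2)[of x "u x"] x t by simp
      then show ?thesis
        using vu[of x] x t by (simp add: f_def truncated_rhs_def v_def[of "x - a - c * clamp d (u x)"])
    qed
    then have "integral {r..t} (\<lambda>x. f x (u x)) = integral {r..t} (G v)"
      by (rule Henstock_Kurzweil_Integration.integral_cong)
    then show ?thesis using u(2)[OF t] vu[OF t] by simp
  qed
  ultimately show ?thesis by (intro exI[of _ v]) (auto simp: v_def)
qed

definition solves_upto :: "real \<Rightarrow> (real \<Rightarrow> real) \<Rightarrow> (real \<Rightarrow> real) \<Rightarrow> bool" where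
  "solves_upto r \<phi> v \<longleftrightarrow> continuous_on {..r} v \<and> (\<forall>t\<le>0. v t = \<phi> t) \<and>
    (\<forall>t\<in>{0..r}. v t = \<phi> 0 + integral {0..t} (G v))"

lemma extend_solution:
  assumes r: "0 \<le> r" and v: "solves_upto r \<phi> v"
  shows "\<exists>w. solves_upto (r + h) \<phi> w \<and> (\<forall>t\<le>r. w t = v t)"
proof -
  have cont: "continuous_on {..r} v" using v by (simp add: solves_upto_def)
  obtain w where w: "continuous_on {..r + h} w" "\<And>t. t \<le> r \<Longrightarrow> w t = v t"
    "\<And>t. t \<in> {r..r + h} \<Longrightarrow> w t = v r + integral {r..t} (G w)"
    using one_step[OF cont] by blast
  have agree: "integral {0..t} (G w) = integral {0..t} (G v)" if "t \<le> r" for t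
    using that by (intro Henstock_Kurzweil_Integration.integral_cong G_cong) (auto simp: w)
  have "w t = \<phi> 0 + integral {0..t} (G w)" if t: "t \<in> {0..r + h}" for t
  proof (cases "t \<le> r")
    case True
    then show ?thesis using v t agree[of t] w(2)[of t] by (simp add: solves_upto_def)
  next
    case False
    have "integral {0..r} (G w) + integral {r..t} (G w) = integral {0..t} (G w)"
      using r t False continuous_on_subset[OF continuous_on_G[OF w(1)], of "{0..t}"]
      by (intro Henstock_Kurzweil_Integration.integral_combine integrable_continuous_real) auto
    moreover have "v r = \<phi> 0 + integral {0..r} (G v)" using v r by (simp add: solves_upto_def)
    ultimately show ?thesis using w(3)[of t] t False agree[of r] by simp
  qed
  then show ?thesis using w v r by (intro exI[of _ w]) (auto simp: solves_upto_def)
qed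

lemma global_solution:
  assumes \<phi>: "continuous_on {..0} \<phi>"
  shows "\<exists>u. \<forall>r\<ge>0. solves_upto r \<phi> u"
proof -
  have "\<exists>V. \<forall>n. solves_upto (real n * h) \<phi> (V n) \<and> (\<forall>t\<le>real n * h. V (Suc n) t = V n t)"
  proof (rule dependent_nat_choice)
    show "\<exists>v. solves_upto (real 0 * h) \<phi> v"
      using \<phi> by (intro exI[of _ \<phi>]) (simp add: solves_upto_def)
    fix v n assume "solves_upto (real n * h) \<phi> v"
    then show "\<exists>w. solves_upto (real (Suc n) * h) \<phi> w \<and> (\<forall>t\<le>real n * h. w t = v t)"
      using extend_solution[of "real n * h" \<phi> v] h_pos by (simp add: algebra_simps)
  qed
  then obtain V where V: "\<And>n. solves_upto (real n * h) \<phi> (V n)"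
    "\<And>n t. t \<le> real n * h \<Longrightarrow> V (Suc n) t = V n t" by blast
  have agree: "V m t = V n t" if "n \<le> m" "t \<le> real n * h" for n m t
    using that
  proof (induction m rule: dec_induct)
    case (step m)
    have "real n * h \<le> real m * h" using step h_pos by simp
    then show ?case using step V(2)[of t m] by simp
  qed simp
  define u where "u t = V (nat \<lceil>t / h\<rceil>) t" for t
  have uV: "u t = V n t" if "t \<le> real n * h" for t n
  proof -
    let ?m = "nat \<lceil>t / h\<rceil>"
    have "t / h \<le> real ?m" by linarith
    then have "t \<le> real ?m * h" using h_pos by (simp add: field_simps)
    then show ?thesis unfolding u_def using agree[of ?m n t] agree[of n ?m t] that
      by (cases "?m \<le> n") auto
  qed
  have "solves_upto r \<phi> u" if r: "0 \<le> r" for r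
  proof -
    obtain n :: nat where "r / h \<le> real n" using real_arch_simple by blast
    then have n: "r \<le> real n * h" using h_pos by (simp add: field_simps)
    note Vn = V(1)[of n, unfolded solves_upto_def]
    have "continuous_on {..r} u"
      using Vn n uV by (subst continuous_on_cong[OF refl, of _ _ "V n"])
        (auto elim!: continuous_on_subset)
    moreover have "u t = \<phi> 0 + integral {0..t} (G u)" if t: "t \<in> {0..r}" for t
    proof -
      have "integral {0..t} (G u) = integral {0..t} (G (V n))"
        using t n by (intro Henstock_Kurzweil_Integration.integral_cong G_cong uV) auto
      then show ?thesis using Vn t n uV[of t n] by simp
    qed
    moreover have "u t = \<phi> t" if "t \<le> 0" for t
    proof -
      have "t \<le> real n * h" using that r n by linarith
      then show ?thesis using Vn that uV[of t n] by simp
    qed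
    ultimately show ?thesis by (simp add: solves_upto_def)
  qed
  then show ?thesis by blast
qed

lemma solves_upto_deriv:
  assumes v: "solves_upto r \<phi> v" and t: "t \<in> {0..r}"
  shows "(v has_real_derivative G v t) (at t within {0..r})"
proof -
  have "continuous_on {0..r} (G v)"
    using v by (intro continuous_on_subset[OF continuous_on_G[of r]]) (auto simp: solves_upto_def)
  from integral_has_real_derivative[OF this t]
  have "((\<lambda>t. \<phi> 0 + integral {0..t} (G v)) has_real_derivative G v t) (at t within {0..r})"
    by (auto intro!: derivative_eq_intros)
  then show ?thesis
    by (rule has_field_derivative_transform_within[OF _ zero_less_one t])
      (use v in \<open>auto simp: solves_upto_def\<close>)
qed

end

lemma at_within_time_interval:
  "0 \<le> t \<Longrightarrow> t < r \<Longrightarrow> ereal r \<le> T \<Longrightarrow>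
    at t within {s. 0 \<le> s \<and> ereal s < T} = at t within {0..r}"
proof (rule at_within_nhd[of t "{..<r}"])
  assume *: "ereal r \<le> T"
  have "ereal s < T" if "s < r" for s
    using that * by (meson ereal_less_eq(3) less_ereal.simps(1) less_le_trans)
  then show "{s. 0 \<le> s \<and> ereal s < T} \<inter> {..<r} - {t} = {0..r} \<inter> {..<r} - {t}" by auto
qed auto

lemma ereal_between:
  assumes "ereal t < T"
  obtains r where "t < r" "ereal r < T"
  using ereal_dense2[OF assms] by auto

lemma dde_solutionI:
  assumes "0 < T" "\<And>t. t \<le> 0 \<Longrightarrow> u t = \<phi> t"
    and deriv: "\<And>r t. ereal r < T \<Longrightarrow> t \<in> {0..r} \<Longrightarrow>
      (u has_real_derivative dde_rhs \<mu> \<sigma> a c u t) (at t within {0..r})"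
    and cont: "\<And>r. ereal r < T \<Longrightarrow> continuous_on {0..r} (dde_rhs \<mu> \<sigma> a c u)"
    and arg: "\<And>t. 0 \<le> t \<Longrightarrow> ereal t < T \<Longrightarrow> ereal (t - a - c * u t) < T"
  shows "dde_solution \<mu> \<sigma> a c \<phi> T u"
  unfolding dde_solution_def
proof (intro conjI exI[of _ "dde_rhs \<mu> \<sigma> a c u"] allI impI)
  let ?S = "{t. 0 \<le> t \<and> ereal t < T}"
  have at: "at t within ?S = at t within {0..r}" if "0 \<le> t" "t < r" "ereal r < T" for t r
    using at_within_time_interval[of t r T] that by simp
  show "continuous_on ?S (dde_rhs \<mu> \<sigma> a c u)"
    unfolding continuous_on_eq_continuous_within
  proof
    fix t assume t: "t \<in> ?S"
    then obtain r where r: "t < r" "ereal r < T" using ereal_between by blast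
    then have "continuous (at t within {0..r}) (dde_rhs \<mu> \<sigma> a c u)"
      using cont[of r] t by (auto simp: continuous_on_eq_continuous_within)
    then show "continuous (at t within ?S) (dde_rhs \<mu> \<sigma> a c u)" using at[of t r] t r by simp
  qed
  fix t assume t: "0 \<le> t \<and> ereal t < T"
  then obtain r where r: "t < r" "ereal r < T" using ereal_between by blast
  show "(u has_real_derivative dde_rhs \<mu> \<sigma> a c u t) (at t within ?S)"
    using deriv[of r t] at[of t r] t r by simp
qed (use assms in \<open>auto simp: dde_rhs_def\<close>)

lemma dde_solution_deriv:
  assumes "dde_solution \<mu> \<sigma> a c \<phi> T u" "0 \<le> t" "t \<le> r" "ereal r < T"
  shows "(u has_real_derivative dde_rhs \<mu> \<sigma> a c u t) (at t within {0..r})"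
proof -
  have "ereal t < T" using assms(3,4) by (meson ereal_less_eq(3) le_less_trans)
  then have "(u has_real_derivative dde_rhs \<mu> \<sigma> a c u t) (at t within {t. 0 \<le> t \<and> ereal t < T})"
    using assms(1,2) by (auto simp: dde_solution_def dde_rhs_def)
  moreover have "{0..r} \<subseteq> {t. 0 \<le> t \<and> ereal t < T}"
    using assms(4) by (auto intro: le_less_trans[of _ "ereal r"])
  ultimately show ?thesis by (rule has_field_derivative_subset)
qed

context stable_dde
begin

lemma exists_global_solution:
  assumes \<phi>: "continuous_on {..0} \<phi>" and small: "\<And>s. s \<in> {- R..0} \<Longrightarrow> \<bar>\<phi> s\<bar> < \<delta>2"
  shows "\<exists>u. dde_solution \<mu> \<sigma> a c \<phi> \<infinity> u"
proof -
  interpret truncated_dde \<mu> \<sigma> a c \<delta> using delta c_delta by unfold_locales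
  obtain u where u: "\<And>r. 0 \<le> r \<Longrightarrow> solves_upto r \<phi> u" using global_solution[OF \<phi>] by blast
  have u\<phi>: "u t = \<phi> t" if "t \<le> 0" for t using u[of 0] that by (simp add: solves_upto_def)
  have cont: "continuous_on {..r} u" if "0 \<le> r" for r using u[OF that] by (simp add: solves_upto_def)
  have bound: "\<bar>u s\<bar> < \<delta>" if "0 \<le> s" for s
  proof (rule stays_bounded[of u s])
    show "\<bar>u t\<bar> < \<delta>2" if "t \<in> {- R..0}" for t using small that u\<phi> by simp
    show "continuous_on {0..s} u" using cont[OF that] by (rule continuous_on_subset) auto
    fix x t assume x: "x \<in> {0..s}" and le: "\<And>y. y \<in> {0..x} \<Longrightarrow> \<bar>u y\<bar> \<le> \<delta>" and t: "t \<in> {0..x}"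
    show "(u has_real_derivative rhs u t) (at t within {0..x})"
      using solves_upto_deriv[OF u t] truncated_rhs_eq[of u t, OF le[OF t]] x by simp
  qed (use that in simp)
  have rhs: "G u t = rhs u t" if "0 \<le> t" for t
    using bound[OF that] by (intro truncated_rhs_eq) simp
  have "dde_solution \<mu> \<sigma> a c \<phi> \<infinity> u"
  proof (rule dde_solutionI)
    fix r t :: real assume t: "t \<in> {0..r}"
    show "(u has_real_derivative rhs u t) (at t within {0..r})"
      using solves_upto_deriv[OF u t] rhs[of t] t by simp
  next
    fix r :: real
    show "continuous_on {0..r} (rhs u)"
    proof (cases "0 \<le> r")
      case True
      have "continuous_on {0..r} (G u)"
        using continuous_on_G[OF cont[OF True]] by (rule continuous_on_subset) auto
      then show ?thesis using rhs by (subst continuous_on_cong[OF refl, of _ _ "G u"]) auto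
    qed simp
  qed (use u\<phi> in auto)
  then show ?thesis by blast
qed

lemma solution_bounded:
  assumes sol: "dde_solution \<mu> \<sigma> a c \<phi> T u" and small: "\<And>s. s \<in> {- R..0} \<Longrightarrow> \<bar>\<phi> s\<bar> < \<delta>2"
    and t: "0 \<le> t" "ereal t < T"
  shows "\<bar>u t\<bar> < \<delta>"
proof (rule stays_bounded[of u t])
  show "\<bar>u s\<bar> < \<delta>2" if "s \<in> {- R..0}" for s
    using small sol that by (auto simp: dde_solution_def)
  show "continuous_on {0..t} u"
    using t by (intro DERIV_continuous_on[OF dde_solution_deriv[OF sol]]) auto
  fix x s assume x: "x \<in> {0..t}" and s: "s \<in> {0..x}"
  have "ereal x < T" using x t by (meson atLeastAtMost_iff ereal_less_eq(3) le_less_trans)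
  then show "(u has_real_derivative rhs u s) (at s within {0..x})"
    using dde_solution_deriv[OF sol] s by simp
qed (use t in simp)

lemma maximal_solution_global:
  assumes max: "maximal_dde_solution \<mu> \<sigma> a c \<phi> T u" and \<phi>: "continuous_on {..0} \<phi>"
    and small: "\<And>s. s \<in> {- R..0} \<Longrightarrow> \<bar>\<phi> s\<bar> < \<delta>2"
  shows "T = \<infinity>"
proof (rule ccontr)
  assume "T \<noteq> \<infinity>"
  have sol: "dde_solution \<mu> \<sigma> a c \<phi> T u" using max by (simp add: maximal_dde_solution_def)
  then have "0 < T" by (simp add: dde_solution_def)
  with \<open>T \<noteq> \<infinity>\<close> obtain r where T: "T = ereal r" and r: "0 < r" by (cases T) auto
  have u\<phi>: "u t = \<phi> t" if "t \<le> 0" for t using sol that by (simp add: dde_solution_def)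
  have u_bound: "\<bar>u t\<bar> < \<delta>" if "0 \<le> t" "t < r" for t
    using solution_bounded[OF sol small] that by (simp add: T)
  have u_arg: "t - a - c * u t < r" if "0 \<le> t" "t < r" for t
    using sol that by (auto simp: dde_solution_def T)
  have deriv: "(u has_real_derivative rhs u t) (at t within {0..s})" if "0 \<le> t" "t \<le> s" "s < r" for s t
    using dde_solution_deriv[OF sol, of t s] that by (simp add: T)
  have cont_u: "continuous_on {..<r} u"
  proof -
    have "continuous_on {..s} u" if "0 \<le> s" "s < r" for s
    proof -
      have "continuous_on {..0} u" using \<phi> u\<phi> by (subst continuous_on_cong[OF refl, of _ _ \<phi>]) auto
      moreover have "continuous_on {0..s} u"
        using that by (intro DERIV_continuous_on[OF deriv]) auto
      moreover have "{..s} = {..0} \<union> {0..s}" using that by auto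
      ultimately show ?thesis by (simp add: continuous_on_closed_Un)
    qed
    then have "continuous_on {..<s} u" if "s \<in> {0..<r}" for s
      using that by (rule_tac continuous_on_subset[of "{..s}"]) auto
    then have "continuous_on (\<Union>s\<in>{0..<r}. {..<s}) u" by (intro continuous_on_open_UN) auto
    moreover have "(\<Union>s\<in>{0..<r}. {..<s}) = {..<r}"
    proof (intro equalityI subsetI)
      fix x assume "x \<in> {..<r}"
      then have "max 0 ((x + r) / 2) \<in> {0..<r}" "x < max 0 ((x + r) / 2)" using r by (auto simp: less_max_iff_disj)
      then show "x \<in> (\<Union>s\<in>{0..<r}. {..<s})" by blast
    qed auto
    ultimately show ?thesis by simp
  qed
  have u_window: "\<bar>u t\<bar> \<le> \<delta>" if "- R \<le> t" "t < r" for t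
    using that u_bound[of t] small[of t] u\<phi>[of t] \<delta>2_less by (cases "0 \<le> t") auto
  have rhs_bound: "\<bar>rhs u t\<bar> \<le> (\<bar>\<mu>\<bar> + \<bar>\<sigma>\<bar>) * \<delta>" if "0 \<le> t" "t < r" for t
  proof -
    have "\<bar>c * u t\<bar> \<le> \<bar>c\<bar> * \<delta>" using u_bound[OF that] by (simp add: abs_mult mult_left_mono)
    then have "\<bar>u (t - a - c * u t)\<bar> \<le> \<delta>"
      using u_arg[OF that] that by (intro u_window) (auto simp: R_def)
    then have "\<bar>\<mu>\<bar> * \<bar>u t\<bar> + \<bar>\<sigma>\<bar> * \<bar>u (t - a - c * u t)\<bar> \<le> \<bar>\<mu>\<bar> * \<delta> + \<bar>\<sigma>\<bar> * \<delta>"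
      using u_bound[OF that] by (intro add_mono mult_left_mono) auto
    then show ?thesis
      using abs_triangle_ineq[of "\<mu> * u t" "\<sigma> * u (t - a - c * u t)"]
      by (simp add: dde_rhs_def abs_mult distrib_right)
  qed
  have lip: "\<bar>u x - u y\<bar> \<le> (\<bar>\<mu>\<bar> + \<bar>\<sigma>\<bar>) * \<delta> * \<bar>x - y\<bar>" if "x \<in> {0..<r}" "y \<in> {0..<r}" for x y
  proof -
    have "norm (u x - u y) \<le> (\<bar>\<mu>\<bar> + \<bar>\<sigma>\<bar>) * \<delta> * norm (x - y)"
    proof (rule field_differentiable_bound)
      fix z assume z: "z \<in> {0..max x y}"
      have "max x y < r" using that by simp
      then show "(u has_real_derivative rhs u z) (at z within {0..max x y})"
        "norm (rhs u z) \<le> (\<bar>\<mu>\<bar> + \<bar>\<sigma>\<bar>) * \<delta>"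
        using z deriv[of z "max x y"] rhs_bound[of z] by auto
    qed (use that in auto)
    then show ?thesis by simp
  qed
  have "((\<bar>\<mu>\<bar> + \<bar>\<sigma>\<bar>) * \<delta>)-lipschitz_on {0..<r} u"
    using lip delta by (intro lipschitz_onI) (auto simp: dist_real_def)
  then have uc: "uniformly_continuous_on {0..<r} u" by (rule lipschitz_on_uniformly_continuous)
  have "r \<in> closure {0..<r}" using r by simp
  with uc obtain l where "(u \<longlongrightarrow> l) (at r within {0..<r})"
    by (rule uniformly_continuous_on_extension_at_closure)
  moreover have "at r within {0..<r} = at_left r"
    using r by (intro at_within_nhd[of _ "{0<..}"]) auto
  ultimately have l: "(u \<longlongrightarrow> l) (at_left r)" by simp
  have l_bound: "\<bar>l\<bar> \<le> \<delta>"
  proof (rule tendsto_upperbound[OF tendsto_rabs[OF l]])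
    show "\<forall>\<^sub>F t in at_left r. \<bar>u t\<bar> \<le> \<delta>"
      using eventually_at_left_real[OF r] by eventually_elim (auto intro!: less_imp_le[OF u_bound])
  qed simp
  define \<psi> where "\<psi> t = (if t < r then u t else l)" for t
  have cont_\<psi>: "continuous_on {..r} \<psi>"
    unfolding continuous_on_eq_continuous_within
  proof
    fix t assume t: "t \<in> {..r}"
    show "continuous (at t within {..r}) \<psi>"
    proof (cases "t = r")
      case True
      have "(\<psi> \<longlongrightarrow> l) (at_left r)"
        using l by (rule Lim_transform_eventually)
          (auto simp: \<psi>_def eventually_at_filter)
      moreover have "at r within {..r} = at_left r" by (rule at_within_nhd[of _ UNIV]) auto
      ultimately show ?thesis by (simp add: True continuous_within \<psi>_def)
    next
      case False
      then have "t < r" using t by simp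
      then have "isCont u t" using cont_u by (simp add: continuous_on_eq_continuous_at)
      then have "isCont \<psi> t"
        using \<open>t < r\<close> by (subst isCont_cong[of _ u])
          (auto simp: \<psi>_def intro!: eventually_mono[OF eventually_nhds_in_open[of "{..<r}"]])
      then show ?thesis by (rule continuous_at_imp_continuous_at_within)
    qed
  qed
  define gap where "gap = (a - \<bar>c\<bar> * \<delta>) / (2 * (\<bar>c\<bar> + 1))"
  define d where "d = \<delta> + gap"
  have gap: "0 < gap" using c_delta by (simp add: gap_def)
  then have "\<bar>c\<bar> * gap \<le> (\<bar>c\<bar> + 1) * gap" by (intro mult_right_mono) auto
  also have "\<dots> = (a - \<bar>c\<bar> * \<delta>) / 2" by (simp add: gap_def field_simps)
  finally have "\<bar>c\<bar> * d < a" using c_delta by (simp add: d_def distrib_left)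
  moreover have \<delta>d: "\<delta> < d" using gap by (simp add: d_def)
  ultimately interpret truncated_dde \<mu> \<sigma> a c d using delta by unfold_locales auto
  obtain v where v: "continuous_on {..r + h} v" "\<And>t. t \<le> r \<Longrightarrow> v t = \<psi> t"
    "\<And>t. t \<in> {r..r + h} \<Longrightarrow> v t = \<psi> r + integral {r..t} (G v)"
    using one_step[OF cont_\<psi>] by blast
  have vu: "v t = u t" if "t < r" for t using v(2)[of t] that by (simp add: \<psi>_def)
  have cont_G: "continuous_on {..r + h} (G v)" by (rule continuous_on_G[OF v(1)])
  have Gv: "G v t = rhs u t" if "0 \<le> t" "t < r" for t
    using truncated_rhs_eq[of v t d \<mu> \<sigma> a c] u_bound[OF that] \<delta>d vu u_arg[OF that] that
    by (simp add: dde_rhs_def)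
  have int: "(G v has_integral v t - v 0) {0..t}" if t: "0 \<le> t" "t \<le> r" for t
  proof (rule fundamental_theorem_of_calculus_interior[OF t(1)])
    show "continuous_on {0..t} v" using t h_pos by (intro continuous_on_subset[OF v(1)]) auto
    fix x assume x: "x \<in> {0<..<t}"
    have "(u has_real_derivative rhs u x) (at x within {0..(x + t) / 2})"
      using x t by (intro deriv) auto
    then have "(u has_real_derivative rhs u x) (at x)"
      using x by (simp add: at_within_Icc_at)
    then have "(v has_real_derivative rhs u x) (at x)"
      by (rule has_field_derivative_transform_within_open[of _ _ _ "{..<r}"])
        (use x t vu in auto)
    then show "(v has_vector_derivative G v x) (at x)"
      using Gv[of x] x t by (simp add: has_real_derivative_iff_has_vector_derivative)
  qed
  have solves: "solves_upto (r + h) \<phi> v"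
    unfolding solves_upto_def
  proof (intro conjI allI impI ballI)
    show v\<phi>: "v t = \<phi> t" if "t \<le> 0" for t using vu u\<phi> that r by simp
    fix t assume t: "t \<in> {0..r + h}"
    show "v t = \<phi> 0 + integral {0..t} (G v)"
    proof (cases "t \<le> r")
      case True
      then show ?thesis using int[of t] v\<phi>[of 0] t by (simp add: integral_unique)
    next
      case False
      have "integral {0..r} (G v) + integral {r..t} (G v) = integral {0..t} (G v)"
        using t False r
        by (intro Henstock_Kurzweil_Integration.integral_combine integrable_continuous_real
            continuous_on_subset[OF cont_G]) auto
      moreover have "integral {0..r} (G v) = v r - v 0" using int[of r] r by (simp add: integral_unique)
      ultimately show ?thesis using v(3)[of t] v(2)[of r] v\<phi>[of 0] t False by simp
    qed
  qed (rule v(1))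
  have vr: "v r = l" using v(2)[of r] by (simp add: \<psi>_def)
  have "continuous_on {r..r + h} v" by (rule continuous_on_subset[OF v(1)]) auto
  moreover have "r \<in> {r..r + h}" "0 < d - \<bar>l\<bar>" using h_pos l_bound \<delta>d by auto
  ultimately obtain e where e: "0 < e"
    "\<And>t. t \<in> {r..r + h} \<Longrightarrow> dist t r < e \<Longrightarrow> dist (v t) (v r) < d - \<bar>l\<bar>"
    unfolding continuous_on_iff by meson
  define s where "s = r + min e h"
  have s: "r < s" "s \<le> r + h" using e(1) h_pos by (auto simp: s_def)
  have v_bound: "\<bar>v t\<bar> \<le> d" if "0 \<le> t" "t < s" for t
  proof (cases "t < r")
    case True
    then show ?thesis using u_bound[OF that(1)] vu \<delta>d by auto
  next
    case False
    have "dist (v t) (v r) < d - \<bar>l\<bar>" using False that by (intro e(2)) (auto simp: s_def dist_real_def)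
    then show ?thesis by (simp add: vr dist_real_def)
  qed
  have rhs_v: "G v t = rhs v t" if "0 \<le> t" "t < s" for t
    using v_bound[OF that] by (rule truncated_rhs_eq)
  have "dde_solution \<mu> \<sigma> a c \<phi> (ereal s) v"
  proof (rule dde_solutionI)
    show "v t = \<phi> t" if "t \<le> 0" for t using vu u\<phi> that r by simp
    fix x t assume x: "ereal x < ereal s" "t \<in> {0..x}"
    have "(v has_real_derivative G v t) (at t within {0..r + h})"
      using x s by (intro solves_upto_deriv[OF solves]) auto
    then show "(v has_real_derivative rhs v t) (at t within {0..x})"
      using rhs_v[of t] x s by (auto elim!: has_field_derivative_subset)
  next
    fix x assume x: "ereal x < ereal s"
    have "continuous_on {0..x} (G v)" using x s by (intro continuous_on_subset[OF cont_G]) auto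
    then show "continuous_on {0..x} (rhs v)"
      using rhs_v x by (subst continuous_on_cong[OF refl, of _ _ "G v"]) auto
  next
    fix t assume t: "0 \<le> t" "ereal t < ereal s"
    have "clamp d (v t) = v t" using v_bound[of t] t by (auto simp: clamp_def)
    then show "ereal (t - a - c * v t) < ereal s" using arg_bounds(2)[of t "v t"] t h_pos by simp
  qed (use r s in simp)
  then have "\<exists>T' v. T < T' \<and> dde_solution \<mu> \<sigma> a c \<phi> T' v \<and> (\<forall>t. ereal t < T \<longrightarrow> v t = u t)"
    using s(1) vu by (intro exI[of _ "ereal s"] exI[of _ v]) (simp add: T)
  then show False using max by (simp add: maximal_dde_solution_def)
qed

lemma maximal_solution_stable:
  assumes max: "maximal_dde_solution \<mu> \<sigma> a c \<phi> T u" and \<phi>: "continuous_on {..0} \<phi>"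
    and small: "\<And>s. s \<in> {- R..0} \<Longrightarrow> \<bar>\<phi> s\<bar> < \<delta>2"
  shows "T = \<infinity> \<and> (\<forall>t\<ge>0. \<bar>u t\<bar> \<le> \<delta>) \<and> (u \<longlongrightarrow> 0) at_top"
proof -
  have T: "T = \<infinity>" by (rule maximal_solution_global[OF assms])
  have sol: "dde_solution \<mu> \<sigma> a c \<phi> \<infinity> u" using max by (simp add: maximal_dde_solution_def T)
  have bound: "\<bar>u t\<bar> \<le> \<delta>" if "0 \<le> t" for t
    using solution_bounded[OF sol small that] by simp
  have "(u has_real_derivative rhs u t) (at t within {0..})" if "0 \<le> t" for t
    using dde_solution_deriv[OF sol that, of "t + 1"] at_within_time_interval[OF that, of "t + 1" \<infinity>]
    by (simp add: atLeast_def)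
  from tends_to_zero[OF this bound] show ?thesis using T bound by blast
qed

end

theorem theorem4p7:
  fixes k :: nat and a c \<mu> \<sigma> :: real
  assumes "k \<in> {1, 2, 3}" and "a > 0" and "c \<noteq> 0"
    and "\<sigma> \<le> \<mu>" and "\<sigma> < - \<mu>"
    and "Pfun \<mu> \<sigma> a 1 0 k < 1"
  shows "(\<exists>\<delta>1. 0 < \<delta>1 \<and> \<delta>1 < \<bar>a / c\<bar> \<and> Pfun \<mu> \<sigma> a \<delta>1 c k < \<delta>1) \<and>
    (\<forall>\<delta>1. 0 < \<delta>1 \<and> \<delta>1 < \<bar>a / c\<bar> \<and> Pfun \<mu> \<sigma> a \<delta>1 c k < \<delta>1 \<longrightarrow>
      (\<forall>\<delta> \<delta>2 \<phi>.
        0 < \<delta> \<and> \<delta> \<le> \<delta>1 \<and>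
        \<delta>2 = \<delta> * exp (- real k * (\<bar>\<mu>\<bar> + \<bar>\<sigma>\<bar>) * (a + \<bar>c\<bar> * \<delta>)) \<and>
        continuous_on {..0} \<phi> \<and>
        (\<forall>t\<in>{- a - \<bar>c\<bar> * \<delta>..0}. \<bar>\<phi> t\<bar> < \<delta>2) \<longrightarrow>
        (\<exists>u. dde_solution \<mu> \<sigma> a c \<phi> \<infinity> u) \<and>
        (\<forall>T u. maximal_dde_solution \<mu> \<sigma> a c \<phi> T u \<longrightarrow>
          T = \<infinity> \<and> (\<forall>t\<ge>0. \<bar>u t\<bar> \<le> \<delta>) \<and> (u \<longlongrightarrow> 0) at_top)))"
proof (intro conjI allI impI)
  show "\<exists>\<delta>1. 0 < \<delta>1 \<and> \<delta>1 < \<bar>a / c\<bar> \<and> Pfun \<mu> \<sigma> a \<delta>1 c k < \<delta>1"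
    by (rule Pfun_less_small_delta[OF assms(4,5,2,3,1,6)])
next
  fix \<delta>1 \<delta> \<delta>2 \<phi>
  assume \<delta>1: "0 < \<delta>1 \<and> \<delta>1 < \<bar>a / c\<bar> \<and> Pfun \<mu> \<sigma> a \<delta>1 c k < \<delta>1"
    and *: "0 < \<delta> \<and> \<delta> \<le> \<delta>1 \<and> \<delta>2 = \<delta> * exp (- real k * (\<bar>\<mu>\<bar> + \<bar>\<sigma>\<bar>) * (a + \<bar>c\<bar> * \<delta>)) \<and>
      continuous_on {..0} \<phi> \<and> (\<forall>t\<in>{- a - \<bar>c\<bar> * \<delta>..0}. \<bar>\<phi> t\<bar> < \<delta>2)"
  define L where "L = \<bar>\<mu>\<bar> + \<bar>\<sigma>\<bar>"
  have \<sigma>: "\<sigma> < 0" using assms(4,5) by simp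
  have L: "0 < L" using \<sigma> by (simp add: L_def)
  have c\<delta>1: "\<bar>c\<bar> * \<delta>1 < a" using \<delta>1 assms(2,3) by (simp add: abs_divide field_simps)
  have c\<delta>: "\<bar>c\<bar> * \<delta> \<le> \<bar>c\<bar> * \<delta>1" using * by (simp add: mult_left_mono)
  obtain \<epsilon> where \<epsilon>: "0 < \<epsilon>" "\<epsilon> < 1" and margin: "\<And>v x r. - 1 \<le> v \<and> 0 \<le> r \<and> r \<le> a + \<bar>c\<bar> * \<delta>1 \<and>
      x \<le> 1 \<and> 1 - \<epsilon> \<le> x \<and> - \<epsilon> \<le> \<mu> * x + \<sigma> * v \<longrightarrow>
      Jf \<mu> \<sigma> (prof k (D1 \<mu> \<sigma> \<delta>1 \<bar>c\<bar>) (D2 \<mu> \<sigma> \<delta>1 \<bar>c\<bar>) v) v r < 1 - \<epsilon>"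
    using Jf_margin[OF assms(4,5,2) _ assms(1), of \<delta>1 c] \<delta>1 by blast
  interpret r1: ramp_slopes "D1 \<mu> \<sigma> \<delta>1 \<bar>c\<bar>" "D2 \<mu> \<sigma> \<delta>1 \<bar>c\<bar>" using ramp_slopes_D[OF \<sigma>] \<delta>1 by simp
  interpret stable_dde \<mu> \<sigma> a c \<delta> \<epsilon> "D1 \<mu> \<sigma> \<delta>1 \<bar>c\<bar>" "D2 \<mu> \<sigma> \<delta>1 \<bar>c\<bar>" k
  proof
    show "D1 \<mu> \<sigma> \<delta> \<bar>c\<bar> \<le> D1 \<mu> \<sigma> \<delta>1 \<bar>c\<bar>" "D2 \<mu> \<sigma> \<delta> \<bar>c\<bar> \<le> D2 \<mu> \<sigma> \<delta>1 \<bar>c\<bar>"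
      using * by (simp_all add: D1_mono D2_mono)
    show "(D1 \<mu> \<sigma> \<delta>1 \<bar>c\<bar>)\<^sup>2 \<le> D2 \<mu> \<sigma> \<delta>1 \<bar>c\<bar>" using \<delta>1 by (simp add: D1_square_le_D2)
    have "0 \<le> \<bar>c\<bar> * \<delta>" using * by simp
    then have "L * (L * (\<bar>c\<bar> * \<delta>1)) \<le> L * (L * (a + \<bar>c\<bar> * \<delta>))"
      using c\<delta>1 L by (intro mult_left_mono) auto
    then show "D1 \<mu> \<sigma> \<delta>1 \<bar>c\<bar> \<le> (\<bar>\<mu>\<bar> + \<bar>\<sigma>\<bar>) * (1 + (\<bar>\<mu>\<bar> + \<bar>\<sigma>\<bar>) * (a + \<bar>c\<bar> * \<delta>))"
      unfolding D1_def L_def[symmetric] by (simp add: distrib_left mult.assoc)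
    show "Jf \<mu> \<sigma> (prof k (D1 \<mu> \<sigma> \<delta>1 \<bar>c\<bar>) (D2 \<mu> \<sigma> \<delta>1 \<bar>c\<bar>) v) v r < 1 - \<epsilon>"
      if "- 1 \<le> v" "0 \<le> r" "r \<le> a + \<bar>c\<bar> * \<delta>" "x \<le> 1" "1 - \<epsilon> \<le> x" "- \<epsilon> \<le> \<mu> * x + \<sigma> * v" for v x r
      using margin[of v r x] that c\<delta> by auto
    show "\<bar>c\<bar> * \<delta> < a" using c\<delta> c\<delta>1 by (rule le_less_trans)
  qed (use \<sigma> assms(1,2) * \<epsilon> r1.q_pos in auto)
  have small: "\<bar>\<phi> s\<bar> < stable_dde.\<delta>2 \<mu> \<sigma> a c \<delta> k" if "s \<in> {- R..0}" for s
    using * that by (auto simp: \<delta>2_def R_def)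
  show "\<exists>u. dde_solution \<mu> \<sigma> a c \<phi> \<infinity> u"
    using * small by (intro exists_global_solution) auto
  fix T u assume "maximal_dde_solution \<mu> \<sigma> a c \<phi> T u"
  with * small have "T = \<infinity> \<and> (\<forall>t\<ge>0. \<bar>u t\<bar> \<le> \<delta>) \<and> (u \<longlongrightarrow> 0) at_top"
    by (intro maximal_solution_stable) auto
  then show "T = \<infinity>" "(u \<longlongrightarrow> 0) at_top" "0 \<le> t \<Longrightarrow> \<bar>u t\<bar> \<le> \<delta>" for t by auto
qed

end
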